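(* Let $d \geq 2$ be an integer and let $K$ be an algebraically closed valued field of characteristic $0$. Then there exist $A \in \mathbb{R}_{>0}$ and $B \in \mathbb{R}$ such that $$\max\left\{ M_f^{(1)}, M_f^{(2)} \right\} \geq A \cdot M_f + B$$ for all $f \in \mathrm{Poly}_d(K)$. Moreover, if $d \in \{2,3\}$, then there exist $A \in \mathbb{R}_{>0}$ and $B \in \mathbb{R}$ such that $M_f^{(1)} \geq A \cdot M_f + B$ for all $f \in \mathrm{Poly}_d(K)$.
   Context: A valued field is a field equipped with an absolute value $|\cdot|$ (Archimedean or non-Archimedean). $\mathrm{Poly}_d(K)$ is the set of polynomials of degree $d$ over $K$. For $f \in \mathrm{Poly}_d(K)$, the Green function is $g_f \colon K \to \mathbb{R}_{\geq 0}$, $g_f(z) = \lim_{n \to +\infty} \frac{1}{d^n} \log^+ |f^{\circ n}(z)|$, and the maximal escape rate is $M_f = \max\{ g_f(c) : c \in K, \, f'(c) = 0 \}$. The dynatomic polynomials $\Phi_f^{(p)} \in K[z]$ ($p \geq 1$) are the unique polynomials with $f^{\circ p}(z) - z = \prod_{k \mid p} \Phi_f^{(k)}(z)$ for all $p \geq 1$. There is a unique monic polynomial $\chi_f^{(p)} \in K[\lambda]$ such that $\chi_f^{(p)}(\lambda)^p = \prod_{z} (\lambda - (f^{\circ p})'(z))$, the product being over the roots $z$ of $\Phi_f^{(p)}$ counted with multiplicity. $\Lambda_f^{(p)}$ is the multiset of roots of $\chi_f^{(p)}$ (generically, the multipliers of $f$ at its cycles with period $p$), and $M_f^{(p)} =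 \max_{\lambda \in \Lambda_f^{(p)}} \frac{1}{p} \log|\lambda|$ (with $\log 0 = -\infty$). *)

theory Defs
  imports
    "HOL-Analysis.Analysis"
    "HOL-Computational_Algebra.Polynomial"
begin

text \<open>
  An absolute value on the field \<open>'a\<close>, Archimedean or not. The trivial one is allowed.
\<close>

definition absolute_value :: "('a :: field \<Rightarrow> real) \<Rightarrow> bool" where
  "absolute_value v \<longleftrightarrow>
     (\<forall>x. 0 \<le> v x) \<and>
     (\<forall>x. v x = 0 \<longleftrightarrow> x = 0) \<and>
     (\<forall>x y. v (x * y) = v x * v y) \<and>
     (\<forall>x y. v (x + y) \<le> v x + v y)"

definition log_plus :: "real \<Rightarrow> real" where
  "log_plus t = ln (max 1 t)"

definition green_function :: "('a :: field \<Rightarrow> real) \<Rightarrow> 'a poly \<Rightarrow> 'a \<Rightarrow> real" where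
  "green_function v f z =
     lim (\<lambda>n. 1 / real (degree f) ^ n * log_plus (v ((poly f ^^ n) z)))"

definition max_escape_rate :: "('a :: field_char_0 \<Rightarrow> real) \<Rightarrow> 'a poly \<Rightarrow> real" where
  "max_escape_rate v f = Max (green_function v f ` {c. poly (pderiv f) c = 0})"

definition iterate_poly :: "'a :: comm_ring_1 poly \<Rightarrow> nat \<Rightarrow> 'a poly" where
  "iterate_poly f n = (pcompose f ^^ n) [:0, 1:]"

text \<open>
  The \<open>p\<close>-th member of the family \<open>(\<Phi>\<^sub>k)\<close> defined by
  \<open>f\<^sup>q(z) - z = (\<Prod>k | k dvd q. \<Phi>\<^sub>k)\<close>. Only the identities at the divisors \<open>q\<close> of \<open>p\<close> are
  imposed, as they already determine \<open>\<Phi>\<^sub>p\<close> when \<open>degree f \<ge> 2\<close>; \<open>dynatomic_unique\<close> below shows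
  that the value is the \<open>p\<close>-th member of any family satisfying all of the identities.
\<close>

definition dynatomic :: "'a :: field poly \<Rightarrow> nat \<Rightarrow> 'a poly" where
  "dynatomic f p =
     (THE \<phi>. \<exists>\<Phi>. (\<forall>q>0. q dvd p \<longrightarrow>
                     iterate_poly f q - [:0, 1:] = (\<Prod>k | k dvd q. \<Phi> k)) \<and>
                 \<phi> = \<Phi> p)"

definition multiplier_poly :: "'a :: field poly \<Rightarrow> nat \<Rightarrow> 'a poly" where
  "multiplier_poly f p =
     (THE P. lead_coeff P = 1 \<and>
       P ^ p = (\<Prod>z\<in>#proots (dynatomic f p).
                  [:- poly (pderiv (iterate_poly f p)) z, 1:]))"

definition multiplier_spectrum :: "'a :: field poly \<Rightarrow> nat \<Rightarrow> 'a multiset" where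
  "multiplier_spectrum f p = proots (multiplier_poly f p)"

definition log_abs :: "('a :: field \<Rightarrow> real) \<Rightarrow> 'a \<Rightarrow> ereal" where
  "log_abs v x = (if x = 0 then -\<infinity> else ereal (ln (v x)))"

definition max_multiplier_rate :: "('a :: field \<Rightarrow> real) \<Rightarrow> 'a poly \<Rightarrow> nat \<Rightarrow> ereal" where
  "max_multiplier_rate v f p =
     Max ((\<lambda>\<mu>. ereal (1 / real p) * log_abs v \<mu>) ` set_mset (multiplier_spectrum f p))"

lemma degree_iterate_poly:
  fixes f :: "'a :: field poly"
  shows "degree (iterate_poly f n) = degree f ^ n"
  by (induction n) (simp_all add: iterate_poly_def degree_pcompose)

lemma iterate_poly_neq_X:
  fixes f :: "'a :: field poly"
  assumes "degree f \<ge> 2" "n > 0"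
  shows "iterate_poly f n \<noteq> [:0, 1:]"
proof
  assume "iterate_poly f n = [:0, 1:]"
  then have "degree f ^ n = 1"
    using degree_iterate_poly[of f n] by simp
  with assms show False by simp
qed

lemma dynatomic_families_agree:
  fixes f :: "'a :: field poly"
  assumes deg: "degree f \<ge> 2" and "p > 0"
    and \<Phi>: "\<And>q. q > 0 \<Longrightarrow> q dvd p \<Longrightarrow> iterate_poly f q - [:0, 1:] = (\<Prod>k | k dvd q. \<Phi> k)"
    and \<Psi>: "\<And>q. q > 0 \<Longrightarrow> q dvd p \<Longrightarrow> iterate_poly f q - [:0, 1:] = (\<Prod>k | k dvd q. \<Psi> k)"
  shows "\<Phi> p = \<Psi> p"
proof -
  have "q > 0 \<Longrightarrow> q dvd p \<Longrightarrow> \<Phi> q = \<Psi> q" for q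
  proof (induction q rule: less_induct)
    case (less q)
    have fin: "finite {k. k dvd q}" using less.prems by simp
    have split: "(\<Prod>k | k dvd q. F k) = F q * (\<Prod>k\<in>{k. k dvd q} - {q}. F k)"
      for F :: "nat \<Rightarrow> 'a poly"
      using fin by (intro prod.remove) auto
    have eq: "(\<Prod>k\<in>{k. k dvd q} - {q}. \<Phi> k) = (\<Prod>k\<in>{k. k dvd q} - {q}. \<Psi> k)"
    proof (rule prod.cong)
      fix k assume k: "k \<in> {k. k dvd q} - {q}"
      then have kq: "k dvd q" and "k \<noteq> q" by auto
      have "k \<le> q" by (rule dvd_imp_le[OF kq less.prems(1)])
      with \<open>k \<noteq> q\<close> have "k < q" by linarith
      moreover have "k > 0" by (rule dvd_pos_nat[OF less.prems(1) kq])
      moreover have "k dvd p" by (rule dvd_trans[OF kq less.prems(2)])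
      ultimately
      show "\<Phi> k = \<Psi> k" by (rule less.IH)
    qed simp
    have "iterate_poly f q - [:0, 1:] \<noteq> 0"
      using iterate_poly_neq_X[OF deg] less.prems by simp
    then have nz: "(\<Prod>k | k dvd q. \<Psi> k) \<noteq> 0"
      unfolding \<Psi>[OF less.prems] .
    have "(\<Prod>k | k dvd q. \<Phi> k) = (\<Prod>k | k dvd q. \<Psi> k)"
      using \<Phi>[OF less.prems] \<Psi>[OF less.prems] by (rule trans[OF sym])
    with nz show ?case
      unfolding split[of \<Phi>] split[of \<Psi>] eq by simp
  qed
  from this[OF \<open>p > 0\<close> dvd_refl] show ?thesis .
qed

lemma dynatomic_eqI:
  fixes f :: "'a :: field poly"
  assumes deg: "degree f \<ge> 2" and "p > 0"
    and \<Phi>: "\<And>q. q > 0 \<Longrightarrow> q dvd p \<Longrightarrow> iterate_poly f q - [:0, 1:] = (\<Prod>k | k dvd q. \<Phi> k)"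
  shows "dynatomic f p = \<Phi> p"
  unfolding dynatomic_def
proof (rule the_equality)
  show "\<exists>\<Phi>'. (\<forall>q>0. q dvd p \<longrightarrow> iterate_poly f q - [:0, 1:] = (\<Prod>k | k dvd q. \<Phi>' k)) \<and> \<Phi> p = \<Phi>' p"
    by (intro exI[of _ \<Phi>] conjI allI impI refl) (rule \<Phi>)
next
  fix \<phi>
  assume "\<exists>\<Phi>'. (\<forall>q>0. q dvd p \<longrightarrow> iterate_poly f q - [:0, 1:] = (\<Prod>k | k dvd q. \<Phi>' k)) \<and> \<phi> = \<Phi>' p"
  then obtain \<Phi>' where \<Phi>': "\<And>q. q > 0 \<Longrightarrow> q dvd p \<Longrightarrow> iterate_poly f q - [:0, 1:] = (\<Prod>k | k dvd q. \<Phi>' k)"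
    and "\<phi> = \<Phi>' p"
    by metis
  have "\<Phi>' p = \<Phi> p"
    by (rule dynatomic_families_agree[OF deg \<open>p > 0\<close> \<Phi>' \<Phi>])
  then show "\<phi> = \<Phi> p" using \<open>\<phi> = \<Phi>' p\<close> by simp
qed

theorem dynatomic_unique:
  fixes f :: "'a :: field poly"
  assumes "degree f \<ge> 2" and "p > 0"
    and "\<And>q. q > 0 \<Longrightarrow> iterate_poly f q - [:0, 1:] = (\<Prod>k | k dvd q. \<Phi> k)"
  shows "dynatomic f p = \<Phi> p"
  by (rule dynatomic_eqI[OF assms(1,2)]) (rule assms(3))

end

theory Submission
  imports Defs
begin

text \<open>
  Conjugate \<open>f\<close> to a monic polynomial fixing 0. The maximal escape rate is then bounded by
  the logarithm of the largest fixed or critical point. If the theorem failed, there would be a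
  sequence of polynomials \<open>f\<^sub>n\<close> of escape rates \<open>M\<^sub>n \<rightarrow> \<infinity>\<close> whose multipliers are
  \<open>exp (o(M\<^sub>n))\<close>. Comparing sequences up to factors \<open>exp (o(M\<^sub>n))\<close> gives, on an ultrapower of
  the field, a Krull valuation that is non-Archimedean with residue characteristic 0 whatever the
  original absolute value was. The ultraproduct of the \<open>f\<^sub>n\<close> has only multipliers of absolute
  value at most 1, and it remains to show that its fixed points are integral.

  If they are not, let \<open>R\<close> be the largest absolute value of a fixed point and group the fixed
  points into at least two clusters, the open discs of radius \<open>R\<close>. Let \<open>U\<close> be such a disc,
  containing \<open>m\<close> fixed points. Every point of the disc of radius \<open>R\<close> has \<open>m\<close> preimages in \<open>U\<close>,
  and \<open>U\<close> contains \<open>m - 1\<close> critical points. A component of the preimage of \<open>U\<close> in \<open>U\<close> mapped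
  with degree 1 contains a repelling fixed point. So all these components have degree at least 2
  and contain at least \<open>m/2\<close> critical points by Riemann-Hurwitz; in particular \<open>m \<ge> 2\<close>, which
  excludes degrees 2 and 3. Fewer than \<open>m/2\<close> critical points are left over any other cluster
  \<open>U'\<close>, so a component of the preimage of \<open>U'\<close> in \<open>U\<close> is mapped onto \<open>U'\<close> with degree 1.
  Exchanging the roles of \<open>U\<close> and \<open>U'\<close> yields a repelling cycle of period 2.

  For bounded escape rates one uses that \<open>d\<close> is the sum of \<open>\<lambda>/(\<lambda> - 1)\<close> over the multipliers
  \<open>\<lambda>\<close> of the fixed points, so that they cannot all be small.
\<close>

section \<open>Valuations and numbers of roots in discs\<close>

text \<open>
  A Krull valuation with residue characteristic 0, given by the divisibility preorder of its
  valuation ring: \<open>x \<sqsubseteq> y\<close> stands for \<open>|x| \<le> |y|\<close>.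
\<close>

locale valuation_preorder =
  fixes le :: "'k :: {alg_closed_field, field_char_0} \<Rightarrow> 'k \<Rightarrow> bool" (infix "\<sqsubseteq>" 50)
  assumes le_total: "x \<sqsubseteq> y \<or> y \<sqsubseteq> x"
    and le_trans [trans]: "x \<sqsubseteq> y \<Longrightarrow> y \<sqsubseteq> z \<Longrightarrow> x \<sqsubseteq> z"
    and le_add: "x \<sqsubseteq> z \<Longrightarrow> y \<sqsubseteq> z \<Longrightarrow> x + y \<sqsubseteq> z"
    and le_mult_right: "x \<sqsubseteq> y \<Longrightarrow> x * w \<sqsubseteq> y * w"
    and le_zero: "x \<sqsubseteq> 0 \<Longrightarrow> x = 0"
    and one_le_of_nat: "n > 0 \<Longrightarrow> 1 \<sqsubseteq> of_nat n"
begin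

definition lt (infix "\<sqsubset>" 50) where "x \<sqsubset> y \<longleftrightarrow> \<not> y \<sqsubseteq> x"

lemma le_refl [simp, intro]: "x \<sqsubseteq> x"
  using le_total by blast

lemma lt_imp_le: "x \<sqsubset> y \<Longrightarrow> x \<sqsubseteq> y"
  using le_total unfolding lt_def by blast

lemma lt_le_trans [trans]: "x \<sqsubset> y \<Longrightarrow> y \<sqsubseteq> z \<Longrightarrow> x \<sqsubset> z"
  using le_trans unfolding lt_def by blast

lemma le_lt_trans [trans]: "x \<sqsubseteq> y \<Longrightarrow> y \<sqsubset> z \<Longrightarrow> x \<sqsubset> z"
  using le_trans unfolding lt_def by blast

lemma lt_trans [trans]: "x \<sqsubset> y \<Longrightarrow> y \<sqsubset> z \<Longrightarrow> x \<sqsubset> z"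
  using le_lt_trans lt_imp_le by blast

lemma lt_irrefl [simp]: "\<not> x \<sqsubset> x"
  unfolding lt_def by simp

lemma not_le: "\<not> x \<sqsubseteq> y \<longleftrightarrow> y \<sqsubset> x"
  unfolding lt_def by simp

lemma not_lt: "\<not> x \<sqsubset> y \<longleftrightarrow> y \<sqsubseteq> x"
  unfolding lt_def by simp

lemma zero_le [simp, intro]: "0 \<sqsubseteq> x"
proof -
  have "0 \<sqsubseteq> (1 :: 'k)"
    using le_total[of 0 1] le_zero[of 1] by auto
  from le_mult_right[OF this, of x] show ?thesis by simp
qed

lemma zero_lt_iff [simp]: "0 \<sqsubset> x \<longleftrightarrow> x \<noteq> 0"
  unfolding lt_def using le_zero by auto

lemma lt_imp_nonzero: "x \<sqsubset> y \<Longrightarrow> y \<noteq> 0"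
  unfolding lt_def by auto

lemma le_mult_left: "x \<sqsubseteq> y \<Longrightarrow> w * x \<sqsubseteq> w * y"
  using le_mult_right[of x y w] by (simp add: mult.commute)

lemma le_mult_cancel: "w \<noteq> 0 \<Longrightarrow> x * w \<sqsubseteq> y * w \<longleftrightarrow> x \<sqsubseteq> y"
  using le_mult_right[of "x * w" "y * w" "inverse w"] le_mult_right[of x y w]
  by (auto simp: field_simps)

lemma lt_mult_cancel: "w \<noteq> 0 \<Longrightarrow> x * w \<sqsubset> y * w \<longleftrightarrow> x \<sqsubset> y"
  by (simp add: lt_def le_mult_cancel)

lemma le_mult: "x \<sqsubseteq> y \<Longrightarrow> z \<sqsubseteq> w \<Longrightarrow> x * z \<sqsubseteq> y * w"
  using le_mult_right[of x y z] le_mult_left[of z w y] le_trans by blast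

lemma lt_mult: "x \<sqsubset> y \<Longrightarrow> z \<sqsubseteq> w \<Longrightarrow> w \<noteq> 0 \<Longrightarrow> x * z \<sqsubset> y * w"
  using le_mult_left[of z w x] lt_mult_cancel[of w x y] le_lt_trans by blast

lemma lt_mult': "x \<sqsubseteq> y \<Longrightarrow> y \<noteq> 0 \<Longrightarrow> z \<sqsubset> w \<Longrightarrow> x * z \<sqsubset> y * w"
  using lt_mult[of z w x y] by (simp add: mult.commute)

lemma minus_one_le_one: "- 1 \<sqsubseteq> 1"
  using le_total[of 1 "-1"] le_mult_right[of 1 "-1" "-1"] by auto

lemma minus_le [simp]: "- x \<sqsubseteq> y \<longleftrightarrow> x \<sqsubseteq> y"
proof -
  have "- x \<sqsubseteq> x" for x
    using le_mult_right[OF minus_one_le_one, of x] by simp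
  from this[of x] this[of "-x"] have "- x \<sqsubseteq> x" "x \<sqsubseteq> - x" by simp_all
  thus ?thesis using le_trans by blast
qed

lemma le_minus [simp]: "x \<sqsubseteq> - y \<longleftrightarrow> x \<sqsubseteq> y"
proof -
  have "y \<sqsubseteq> - y" "- y \<sqsubseteq> y" using minus_le[of y "-y"] by (auto simp del: minus_le) (simp add: minus_le)
  thus ?thesis using le_trans by blast
qed

lemma lt_minus [simp]: "- x \<sqsubset> y \<longleftrightarrow> x \<sqsubset> y" "x \<sqsubset> - y \<longleftrightarrow> x \<sqsubset> y"
  by (simp_all add: lt_def)

lemma le_diff: "x \<sqsubseteq> z \<Longrightarrow> y \<sqsubseteq> z \<Longrightarrow> x - y \<sqsubseteq> z"
  using le_add[of x z "-y"] by simp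

lemma lt_add: "x \<sqsubset> z \<Longrightarrow> y \<sqsubset> z \<Longrightarrow> x + y \<sqsubset> z"
proof (cases "x \<sqsubseteq> y")
  case True
  assume "y \<sqsubset> z"
  have "x + y \<sqsubseteq> y" using True by (intro le_add) auto
  thus ?thesis using \<open>y \<sqsubset> z\<close> le_lt_trans by blast
next
  case False
  assume "x \<sqsubset> z"
  have "x + y \<sqsubseteq> x" using False lt_imp_le by (intro le_add) (auto simp: not_le)
  thus ?thesis using \<open>x \<sqsubset> z\<close> le_lt_trans by blast
qed

lemma lt_diff: "x \<sqsubset> z \<Longrightarrow> y \<sqsubset> z \<Longrightarrow> x - y \<sqsubset> z"
  using lt_add[of x z "-y"] by simp

lemma lt_diff_commute: "x - y \<sqsubset> z \<longleftrightarrow> y - x \<sqsubset> z"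
  using lt_minus(1)[of "x - y" z] by simp

lemma le_add_of_lt: "z \<sqsubseteq> x \<Longrightarrow> y \<sqsubset> z \<Longrightarrow> z \<sqsubseteq> x + y"
proof (rule ccontr)
  assume "z \<sqsubseteq> x" "y \<sqsubset> z" "\<not> z \<sqsubseteq> x + y"
  hence "(x + y) - y \<sqsubset> z" by (intro lt_diff) (auto simp: not_le)
  thus False using \<open>z \<sqsubseteq> x\<close> by (simp add: lt_def)
qed

lemma le_sum: "(\<And>i. i \<in> I \<Longrightarrow> f i \<sqsubseteq> z) \<Longrightarrow> sum f I \<sqsubseteq> z"
  by (induction I rule: infinite_finite_induct) (auto intro: le_add)

lemma lt_sum: "z \<noteq> 0 \<Longrightarrow> (\<And>i. i \<in> I \<Longrightarrow> f i \<sqsubset> z) \<Longrightarrow> sum f I \<sqsubset> z"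
  by (induction I rule: infinite_finite_induct) (auto intro: lt_add)

text \<open>With \<open>one_le_of_nat\<close> it makes every positive integer a unit of the
  valuation ring; this is how residue characteristic 0 enters
  \<open>dominant_pderiv\<close>.\<close>

lemma of_nat_le_one: "of_nat n \<sqsubseteq> 1"
  by (induction n) (auto intro: le_add)

lemma le_power: "x \<sqsubseteq> y \<Longrightarrow> x ^ n \<sqsubseteq> y ^ n"
  by (induction n) (auto intro: le_mult)

lemma lt_power: "x \<sqsubset> y \<Longrightarrow> n > 0 \<Longrightarrow> x ^ n \<sqsubset> y ^ n"
proof -
  assume *: "x \<sqsubset> y" "n > 0"
  then obtain m where n: "n = Suc m" by (cases n) auto
  show ?thesis unfolding n power_Suc
    using * lt_imp_nonzero by (intro lt_mult le_power lt_imp_le) auto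
qed

lemma power_le_one: "x \<sqsubseteq> 1 \<Longrightarrow> x ^ n \<sqsubseteq> 1"
  using le_power[of x 1 n] by simp

lemma power_lt_one: "x \<sqsubset> 1 \<Longrightarrow> n > 0 \<Longrightarrow> x ^ n \<sqsubset> 1"
  using lt_power[of x 1 n] by simp

lemma exists_minimal:
  assumes "finite A" "A \<noteq> {}"
  shows "\<exists>x\<in>A. \<forall>y\<in>A. f x \<sqsubseteq> f y"
  using assms
proof (induction A rule: finite_ne_induct)
  case (insert a A)
  then obtain x where x: "x \<in> A" "\<forall>y\<in>A. f x \<sqsubseteq> f y" by blast
  show ?case
  proof (cases "f x \<sqsubseteq> f a")
    case True
    thus ?thesis using x by auto
  next
    case False
    hence "f a \<sqsubseteq> f x" using le_total by blast
    thus ?thesis using x le_trans by (intro bexI[of _ a]) auto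
  qed
qed auto

lemma exists_maximal:
  assumes "finite A" "A \<noteq> {}"
  shows "\<exists>x\<in>A. \<forall>y\<in>A. f y \<sqsubseteq> f x"
  using assms
proof (induction A rule: finite_ne_induct)
  case (insert a A)
  then obtain x where x: "x \<in> A" "\<forall>y\<in>A. f y \<sqsubseteq> f x" by blast
  show ?case
  proof (cases "f a \<sqsubseteq> f x")
    case True
    thus ?thesis using x by auto
  next
    case False
    hence "f x \<sqsubseteq> f a" using le_total by blast
    thus ?thesis using x le_trans by (intro bexI[of _ a]) auto
  qed
qed auto

section \<open>Gauss norms, dominant coefficients and root counts\<close>

definition coeffs_le :: "'k poly \<Rightarrow> 'k \<Rightarrow> bool" where
  "coeffs_le p c \<longleftrightarrow> (\<forall>j. coeff p j \<sqsubseteq> c)"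

lemma coeffs_le_add: "coeffs_le p c \<Longrightarrow> coeffs_le q c \<Longrightarrow> coeffs_le (p + q) c"
  by (auto simp: coeffs_le_def intro: le_add)

lemma coeffs_le_diff: "coeffs_le p c \<Longrightarrow> coeffs_le q c \<Longrightarrow> coeffs_le (p - q) c"
  by (auto simp: coeffs_le_def intro: le_diff)

lemma coeffs_le_mult: "coeffs_le p c \<Longrightarrow> coeffs_le q d \<Longrightarrow> coeffs_le (p * q) (c * d)"
  unfolding coeffs_le_def coeff_mult by (intro allI le_sum le_mult) auto

lemma coeffs_le_const: "x \<sqsubseteq> c \<Longrightarrow> coeffs_le [:x:] c"
  by (auto simp: coeffs_le_def coeff_pCons split: nat.splits)

text \<open>Horner's scheme: each step multiplies by \<open>q\<close>, whose Gauss norm is at most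
  1, and adds a coefficient of \<open>p\<close>.\<close>

lemma coeffs_le_pcompose: "coeffs_le p c \<Longrightarrow> coeffs_le q 1 \<Longrightarrow> coeffs_le (p \<circ>\<^sub>p q) c"
proof (induction p)
  case (pCons a p)
  have "coeffs_le p c" using pCons.prems unfolding coeffs_le_def
    by (metis coeff_pCons_Suc)
  hence "coeffs_le (q * (p \<circ>\<^sub>p q)) (1 * c)"
    using pCons by (intro coeffs_le_mult) auto
  moreover have "a \<sqsubseteq> c" using pCons.prems unfolding coeffs_le_def
    by (metis coeff_pCons_0)
  ultimately show ?case
    by (simp add: pcompose_pCons coeffs_le_add coeffs_le_const)
qed (simp add: coeffs_le_def)

lemma poly_le: "coeffs_le p c \<Longrightarrow> x \<sqsubseteq> 1 \<Longrightarrow> poly p x \<sqsubseteq> c"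
  unfolding poly_altdef coeffs_le_def
  using le_mult[of _ c _ 1] power_le_one by (intro le_sum) fastforce

text \<open>
  By multiplicativity of the Gauss norm, \<^term>\<open>dominant p e\<close> says that \<^term>\<open>p\<close> has exactly
  \<^term>\<open>e\<close> roots in the open unit disc.
\<close>

definition dominant :: "'k poly \<Rightarrow> nat \<Rightarrow> bool" where
  "dominant p e \<longleftrightarrow> coeff p e \<noteq> 0 \<and> coeffs_le p (coeff p e) \<and> (\<forall>j<e. coeff p j \<sqsubset> coeff p e)"

lemma dominantI:
  assumes "c \<noteq> 0" "coeffs_le p c" "\<And>j. j < e \<Longrightarrow> coeff p j \<sqsubset> c" "c \<sqsubseteq> coeff p e"
  shows "dominant p e"
  using assms unfolding dominant_def coeffs_le_def
  by (metis le_trans le_zero lt_le_trans)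

text \<open>\<open>e\<close> is the least index at which the Gauss norm is attained.\<close>

lemma dominant_unique:
  assumes "dominant p e" "dominant p e'"
  shows "e = e'"
  using assms unfolding dominant_def coeffs_le_def lt_def
  by (metis linorder_neqE_nat)

text \<open>Gauss's lemma: in the coefficient of index \<open>e + e'\<close> the product of the two
  dominant coefficients is the only term of full size, as every other term involves an index below
  \<open>e\<close> or below \<open>e'\<close>.\<close>

lemma dominant_mult:
  assumes "dominant p e" "dominant q e'"
  shows "dominant (p * q) (e + e')"
proof (rule dominantI)
  let ?c = "coeff p e * coeff q e'"
  show nz: "?c \<noteq> 0" using assms by (auto simp: dominant_def)
  show "coeffs_le (p * q) ?c"
    using assms by (intro coeffs_le_mult) (auto simp: dominant_def)
  have small: "coeff p i * coeff q (n - i) \<sqsubset> ?c" if "i < e \<or> n - i < e'" for n i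
    using that assms unfolding dominant_def coeffs_le_def
    by (auto intro: lt_mult lt_mult')
  show "coeff (p * q) j \<sqsubset> ?c" if "j < e + e'" for j
    unfolding coeff_mult by (rule lt_sum[OF nz], rule small) (use that in auto)
  have "coeff (p * q) (e + e') = ?c + (\<Sum>i\<in>{..e + e'} - {e}. coeff p i * coeff q (e + e' - i))"
    unfolding coeff_mult by (subst sum.remove[of _ e]) auto
  moreover have "(\<Sum>i\<in>{..e + e'} - {e}. coeff p i * coeff q (e + e' - i)) \<sqsubset> ?c"
    by (rule lt_sum[OF nz], rule small) auto
  ultimately show "?c \<sqsubseteq> coeff (p * q) (e + e')"
    by (simp add: le_add_of_lt)
qed

lemma dominant_smult: "c \<noteq> 0 \<Longrightarrow> dominant (smult c p) e \<longleftrightarrow> dominant p e"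
  unfolding dominant_def coeffs_le_def
  by (auto simp: mult.commute[of c] le_mult_cancel lt_mult_cancel)

lemma dominant_linear:
  assumes "b \<noteq> 0"
  shows "dominant [:a, b:] (if a \<sqsubset> b then 1 else 0)"
proof (cases "a \<sqsubset> b")
  case True
  thus ?thesis using assms
    by (auto intro!: dominantI[of b] simp: coeffs_le_def coeff_pCons lt_imp_le split: nat.splits)
next
  case False
  hence "b \<sqsubseteq> a" by (simp add: not_lt)
  thus ?thesis using assms False le_zero
    by (auto intro!: dominantI[of a] simp: coeffs_le_def coeff_pCons split: nat.splits)
qed

text \<open>Non-Archimedean Rouche theorem: a perturbation below the Gauss norm preserves the number
  of roots in the disc.\<close>

lemma dominant_add:
  assumes "dominant p e" "\<And>j. coeff q j \<sqsubset> coeff p e"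
  shows "dominant (p + q) e"
proof (rule dominantI[of "coeff p e"])
  show "coeffs_le (p + q) (coeff p e)"
    using assms by (intro coeffs_le_add) (auto simp: dominant_def coeffs_le_def lt_imp_le)
qed (use assms in \<open>auto simp: dominant_def intro: lt_add le_add_of_lt\<close>)

text \<open>Positive integers have absolute value 1, so differentiation keeps the sizes of the
  coefficients and shifts their indices. A disc with \<open>Suc e\<close> roots thus contains
  \<open>e\<close> critical points.\<close>

lemma dominant_pderiv:
  assumes "dominant p (Suc e)"
  shows "dominant (pderiv p) e"
proof (rule dominantI[of "coeff p (Suc e)"])
  have le: "of_nat n * x \<sqsubseteq> x" for n x
    using le_mult_right[OF of_nat_le_one, of n x] by simp
  show "coeffs_le (pderiv p) (coeff p (Suc e))"
    using assms le le_trans unfolding coeffs_le_def dominant_def coeff_pderiv by blast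
  show "coeff (pderiv p) j \<sqsubset> coeff p (Suc e)" if "j < e" for j
    using assms le le_lt_trans that unfolding dominant_def coeff_pderiv by (meson Suc_mono)
  show "coeff p (Suc e) \<sqsubseteq> coeff (pderiv p) e"
    using le_mult_right[OF one_le_of_nat[of "Suc e"], of "coeff p (Suc e)"]
    by (simp add: coeff_pderiv del: of_nat_Suc)
qed (use assms in \<open>auto simp: dominant_def\<close>)

text \<open>Without zeros in the open unit disc the constant term dominates, so the absolute value
  is constant there.\<close>

lemma poly_dominant_0:
  assumes "dominant p 0" "x \<sqsubset> 1"
  shows "coeff p 0 \<sqsubseteq> poly p x" "poly p x \<sqsubseteq> coeff p 0"
proof -
  show "poly p x \<sqsubseteq> coeff p 0"
    using assms by (intro poly_le) (auto simp: dominant_def lt_imp_le)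
  have nz: "coeff p 0 \<noteq> 0" using assms by (auto simp: dominant_def)
  have "poly p x = coeff p 0 + (\<Sum>i\<in>{..degree p} - {0}. coeff p i * x ^ i)"
    unfolding poly_altdef by (subst sum.remove[of _ 0]) auto
  moreover have "(\<Sum>i\<in>{..degree p} - {0}. coeff p i * x ^ i) \<sqsubset> coeff p 0"
  proof (rule lt_sum[OF nz])
    fix i assume "i \<in> {..degree p} - {0}"
    hence "coeff p i * x ^ i \<sqsubset> coeff p 0 * 1"
      using assms nz by (intro lt_mult' power_lt_one) (auto simp: dominant_def coeffs_le_def)
    thus "coeff p i * x ^ i \<sqsubset> coeff p 0" by simp
  qed
  ultimately show "coeff p 0 \<sqsubseteq> poly p x"
    by (simp add: le_add_of_lt)
qed

definition nroots :: "'k poly \<Rightarrow> 'k \<Rightarrow> 'k \<Rightarrow> nat" where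
  "nroots p z \<rho> = size (filter_mset (\<lambda>r. r - z \<sqsubset> \<rho>) (proots p))"

text \<open>A change of variable turns the disc into the unit disc; each linear factor then counts 1
  or 0 by \<open>dominant_linear\<close>, and \<open>dominant_mult\<close> adds the counts.\<close>

lemma dominant_nroots:
  assumes "p \<noteq> 0" "\<rho> \<noteq> 0"
  shows "dominant (p \<circ>\<^sub>p [:z, \<rho>:]) (nroots p z \<rho>)"
proof -
  obtain A where A: "p = smult (lead_coeff p) (\<Prod>x\<in>#A. [:-x, 1:])"
    using alg_closed_imp_factorization[OF assms(1)] by blast
  have nz: "(\<Prod>x\<in>#A. [:-x, 1:]) \<noteq> 0" for A :: "'k multiset"
    by (auto simp: prod_mset_zero_iff)
  have "dominant ((\<Prod>x\<in>#A. [:-x, 1:]) \<circ>\<^sub>p [:z, \<rho>:]) (nroots (\<Prod>x\<in>#A. [:-x, 1:]) z \<rho>)" for A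
  proof (induction A)
    case empty
    show ?case using dominantI[of 1 1 0]
      by (simp add: nroots_def pcompose_1 coeffs_le_def coeff_1)
  next
    case (add x A)
    have "[:- x, 1:] \<circ>\<^sub>p [:z, \<rho>:] = [:z - x, \<rho>:]"
      by (simp add: pcompose_pCons)
    hence "dominant ([:- x, 1:] \<circ>\<^sub>p [:z, \<rho>:]) (if x - z \<sqsubset> \<rho> then 1 else 0)"
      using dominant_linear[OF assms(2), of "z - x"] by (simp add: lt_diff_commute)
    from dominant_mult[OF this add.IH]
    have "dominant (([:- x, 1:] * (\<Prod>x\<in>#A. [:-x, 1:])) \<circ>\<^sub>p [:z, \<rho>:])
      ((if x - z \<sqsubset> \<rho> then 1 else 0) + nroots (\<Prod>x\<in>#A. [:-x, 1:]) z \<rho>)"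
      by (simp only: pcompose_mult)
    moreover have "nroots ([:- x, 1:] * (\<Prod>x\<in>#A. [:-x, 1:])) z \<rho> =
      (if x - z \<sqsubset> \<rho> then 1 else 0) + nroots (\<Prod>x\<in>#A. [:-x, 1:]) z \<rho>"
      unfolding nroots_def using nz[of A] by (subst proots_mult) (auto simp del: mult_pCons_left)
    ultimately show ?case by simp
  qed
  from this[of A] have "dominant (smult (lead_coeff p) (\<Prod>x\<in>#A. [:-x, 1:]) \<circ>\<^sub>p [:z, \<rho>:])
     (nroots (smult (lead_coeff p) (\<Prod>x\<in>#A. [:-x, 1:])) z \<rho>)"
    using assms by (simp add: pcompose_smult dominant_smult nroots_def)
  thus ?thesis using A by metis
qed

lemma nroots_eqI:
  assumes "dominant (p \<circ>\<^sub>p [:z, \<rho>:]) e" "\<rho> \<noteq> 0"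
  shows "nroots p z \<rho> = e"
proof -
  have "p \<noteq> 0" using assms by (auto simp: dominant_def)
  thus ?thesis using dominant_nroots assms dominant_unique by blast
qed

text \<open>The substitute for Hensel's lemma: roots come from algebraic closedness, and the count
  \<open>Suc 0\<close> places one in the disc.\<close>

lemma dominant_Suc_0_root:
  assumes "dominant (p \<circ>\<^sub>p [:z, \<rho>:]) (Suc 0)" "\<rho> \<noteq> 0"
  obtains x where "x \<sqsubset> 1" "poly p (z + \<rho> * x) = 0"
proof -
  have "p \<noteq> 0" using assms by (auto simp: dominant_def)
  have "filter_mset (\<lambda>r. r - z \<sqsubset> \<rho>) (proots p) \<noteq> {#}"
    using nroots_eqI[OF assms] by (metis nroots_def size_empty nat.distinct(1))
  then obtain r where "r \<in># filter_mset (\<lambda>r. r - z \<sqsubset> \<rho>) (proots p)"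
    by (metis multiset_nonemptyE)
  hence "poly p r = 0" "r - z \<sqsubset> \<rho>" using \<open>p \<noteq> 0\<close> by auto
  hence "(r - z) * inverse \<rho> \<sqsubset> \<rho> * inverse \<rho>"
    using lt_mult_cancel[of "inverse \<rho>" "r - z" \<rho>] assms by simp
  hence "(r - z) / \<rho> \<sqsubset> 1" using assms by (simp add: divide_inverse)
  thus ?thesis using that[of "(r - z) / \<rho>"] assms \<open>poly p r = 0\<close> by simp
qed

end

text \<open>The elements of one \<open>V\<close> are removed from both multisets and the induction
  continues with the rest, which sums over a disjoint family without enumerating it. It will add up
  Riemann-Hurwitz over components.\<close>

lemma size_le_cover:
  fixes B C :: "'a multiset"
  assumes "\<And>V W. V \<in> F \<Longrightarrow> W \<in> F \<Longrightarrow> V = W \<or> V \<inter> W = {}"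
    and "\<And>b. b \<in># B \<Longrightarrow> \<exists>V\<in>F. b \<in> V \<and>
           size (filter_mset (\<lambda>x. x \<in> V) B) \<le> k * size (filter_mset (\<lambda>x. x \<in> V) C)"
  shows "size B \<le> k * size C"
  using assms(2)
proof (induction "size B" arbitrary: B C rule: less_induct)
  case less
  show ?case
  proof (cases "B = {#}")
    case False
    then obtain b where b: "b \<in># B" by blast
    then obtain V where V: "V \<in> F" "b \<in> V"
      "size (filter_mset (\<lambda>x. x \<in> V) B) \<le> k * size (filter_mset (\<lambda>x. x \<in> V) C)"
      using less.prems by blast
    let ?B = "filter_mset (\<lambda>x. x \<notin> V) B" and ?C = "filter_mset (\<lambda>x. x \<notin> V) C"
    have split: "size A = size (filter_mset (\<lambda>x. x \<in> V) A) + size (filter_mset (\<lambda>x. x \<notin> V) A)" for A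
      by (metis multiset_partition size_union)
    have "size (filter_mset (\<lambda>x. x \<in> V) B) > 0"
      using b V by (simp add: nonempty_has_size[symmetric] filter_mset_eq_conv) auto
    hence "size ?B < size B" using split[of B] by linarith
    moreover have "\<exists>W\<in>F. b' \<in> W \<and>
           size (filter_mset (\<lambda>x. x \<in> W) ?B) \<le> k * size (filter_mset (\<lambda>x. x \<in> W) ?C)"
      if b': "b' \<in># ?B" for b'
    proof -
      obtain W where W: "W \<in> F" "b' \<in> W"
        "size (filter_mset (\<lambda>x. x \<in> W) B) \<le> k * size (filter_mset (\<lambda>x. x \<in> W) C)"
        using less.prems b' by auto
      have "V \<inter> W = {}" using assms(1)[OF V(1) W(1)] b' W(2) by auto
      hence "filter_mset (\<lambda>x. x \<in> W) (filter_mset (\<lambda>x. x \<notin> V) A) = filter_mset (\<lambda>x. x \<in> W) A" for A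
        by (auto simp: filter_filter_mset intro!: filter_mset_cong)
      thus ?thesis using W by auto
    qed
    ultimately have "size ?B \<le> k * size ?C"
      by (rule less.hyps)
    thus ?thesis using V(3) split[of B] split[of C] by (simp add: algebra_simps)
  qed auto
qed

section \<open>Fixed points and repelling cycles over a valued field of residue characteristic 0\<close>

lemma degree_diff_less:
  fixes p q :: "'a :: comm_ring_1 poly"
  assumes "degree q < degree p"
  shows "degree (p - q) = degree p" "lead_coeff (p - q) = lead_coeff p"
proof -
  show "degree (p - q) = degree p"
    using degree_add_eq_left[of "-q" p] assms by simp
  thus "lead_coeff (p - q) = lead_coeff p"
    using assms by (simp add: coeff_eq_0)
qed

context valuation_preorder
begin

lemma poly_lt:
  assumes "coeffs_le p c" "coeff p 0 \<sqsubset> c" "x \<sqsubset> 1"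
  shows "poly p x \<sqsubset> c"
  unfolding poly_altdef
proof (rule lt_sum)
  show nz: "c \<noteq> 0" using assms(2) by (rule lt_imp_nonzero)
  fix i
  show "coeff p i * x ^ i \<sqsubset> c"
  proof (cases "i = 0")
    case False
    hence "coeff p i * x ^ i \<sqsubset> c * 1"
      using assms nz by (intro lt_mult' power_lt_one) (auto simp: coeffs_le_def)
    thus ?thesis by simp
  qed (use assms in simp)
qed

lemma poly_pderiv_pcompose_linear:
  "poly (pderiv (p \<circ>\<^sub>p [:z, \<rho>:])) x = poly (pderiv p) (z + \<rho> * x) * \<rho>"
  by (simp add: pderiv_pcompose poly_pcompose pderiv_pCons mult.commute)

lemma dominant_nroots_pderiv:
  assumes "dominant (p \<circ>\<^sub>p [:z, \<rho>:]) (Suc e)" "\<rho> \<noteq> 0"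
  shows "nroots (pderiv p) z \<rho> = e"
proof (rule nroots_eqI)
  have "pderiv (p \<circ>\<^sub>p [:z, \<rho>:]) = smult \<rho> (pderiv p \<circ>\<^sub>p [:z, \<rho>:])"
    by (simp add: pderiv_pcompose pderiv_pCons)
  thus "dominant (pderiv p \<circ>\<^sub>p [:z, \<rho>:]) e"
    using dominant_pderiv[OF assms(1)] assms(2) by (simp add: dominant_smult)
qed (use assms in simp)

lemma pcompose_linear_split: "(p :: 'k poly) \<circ>\<^sub>p [:z, \<rho>:] = (p \<circ>\<^sub>p [:z, 1:]) \<circ>\<^sub>p [:0, \<rho>:]"
  by (subst pcompose_assoc[symmetric]) (simp only: pcompose_pCons, simp)

lemma lt_divide: "\<rho> \<noteq> 0 \<Longrightarrow> x / \<rho> \<sqsubset> 1 \<longleftrightarrow> x \<sqsubset> \<rho>"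
  using lt_mult_cancel[of \<rho> "x / \<rho>" 1] by simp

lemma le_divide: "\<rho> \<noteq> 0 \<Longrightarrow> x / \<rho> \<sqsubseteq> 1 \<longleftrightarrow> x \<sqsubseteq> \<rho>"
  using le_mult_cancel[of \<rho> "x / \<rho>" 1] by simp

end

section \<open>Clusters of fixed points\<close>

locale spread_fixed_points = valuation_preorder +
  fixes F :: "'a poly" and R :: 'a
  assumes monic: "lead_coeff F = 1"
    and deg: "degree F \<ge> 2"
    and one_lt_R: "1 \<sqsubset> R"
    and fixed_le: "poly F a = a \<Longrightarrow> a \<sqsubseteq> R"
begin

lemma R_nonzero: "R \<noteq> 0"
  using one_lt_R by (rule lt_imp_nonzero)

lemma R_lt_power: "R \<sqsubset> R ^ degree F"
proof -
  obtain n where n: "degree F = Suc (Suc n)"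
    using deg by (metis add_2_eq_Suc le_Suc_ex)
  have "1 ^ Suc n \<sqsubset> R ^ Suc n" by (intro lt_power one_lt_R) auto
  hence "1 * R \<sqsubset> R ^ Suc n * R"
    using R_nonzero lt_mult_cancel[of R 1 "R ^ Suc n"] by simp
  thus ?thesis by (simp add: n mult.commute)
qed

abbreviation "crit \<equiv> proots (pderiv F)"

definition cluster_size :: "'a \<Rightarrow> nat" where
  "cluster_size u = nroots (F - [:0, 1:]) u R"

lemma degree_fixed_poly: "degree (F - [:0, 1:]) = degree F" "lead_coeff (F - [:0, 1:]) = 1"
proof -
  have "degree ([:0, 1:] :: 'a poly) < degree F" using deg by simp
  thus "degree (F - [:0, 1:]) = degree F" "lead_coeff (F - [:0, 1:]) = 1"
    using monic degree_diff_less[of "[:0, 1:]" F] by metis+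
qed

lemma degree_minus_const:
  "degree (F - [:w:]) = degree F" "lead_coeff (F - [:w:]) = 1" "F - [:w:] \<noteq> 0"
proof -
  show *: "degree (F - [:w:]) = degree F" "lead_coeff (F - [:w:]) = 1"
    using monic deg degree_diff_less[of "[:w:]" F] by simp_all
  show "F - [:w:] \<noteq> 0"
    using *(2) by auto
qed

text \<open>As \<open>F\<close> is monic, \<open>F - [:0, 1:]\<close> has Gauss norm at least
  \<open>R ^ degree F\<close> on the disc, while passing to \<open>F - [:w:]\<close> adds
  \<open>[:u - w, R:]\<close>, of norm at most \<open>R\<close>. By Rouche every \<open>w\<close> in
  the closed disc of radius \<open>R\<close> has as many preimages in the cluster as the cluster has
  fixed points.\<close>

lemma dominant_cluster:
  assumes "poly F u = u" "w \<sqsubseteq> R"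
  shows "dominant ((F - [:w:]) \<circ>\<^sub>p [:u, R:]) (cluster_size u)"
proof -
  let ?P = "F - [:0, 1:]" and ?L = "[:u, R:]"
  have "?P \<noteq> 0" using degree_fixed_poly deg by (metis degree_0 not_numeral_le_zero)
  hence dom: "dominant (?P \<circ>\<^sub>p ?L) (cluster_size u)"
    unfolding cluster_size_def using R_nonzero by (intro dominant_nroots)
  have "lead_coeff (?P \<circ>\<^sub>p ?L) = R ^ degree F" "degree (?P \<circ>\<^sub>p ?L) = degree F"
    using degree_fixed_poly R_nonzero lead_coeff_comp[of ?L ?P] degree_pcompose[of ?P ?L] by simp_all
  hence "R ^ degree F \<sqsubseteq> coeff (?P \<circ>\<^sub>p ?L) (cluster_size u)"
    using dom unfolding dominant_def coeffs_le_def by metis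
  with R_lt_power have R: "R \<sqsubset> coeff (?P \<circ>\<^sub>p ?L) (cluster_size u)"
    by (rule lt_le_trans)
  have "u - w \<sqsubseteq> R" using assms fixed_le by (intro le_diff) auto
  hence "coeff [:u - w, R:] j \<sqsubset> coeff (?P \<circ>\<^sub>p ?L) (cluster_size u)" for j
    using R le_lt_trans R_nonzero lt_imp_nonzero[OF R] by (auto simp: coeff_pCons split: nat.splits)
  with dom have "dominant (?P \<circ>\<^sub>p ?L + [:u - w, R:]) (cluster_size u)"
    by (rule dominant_add)
  also have "?P \<circ>\<^sub>p ?L + [:u - w, R:] = (F - [:w:]) \<circ>\<^sub>p ?L"
    by (simp add: pcompose_diff pcompose_pCons)
  finally show ?thesis .
qed

lemma nroots_cluster:
  assumes "poly F u = u" "w \<sqsubseteq> R"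
  shows "nroots (F - [:w:]) u R = cluster_size u"
  using dominant_cluster[OF assms] R_nonzero by (intro nroots_eqI)

lemma cluster_size_pos: "poly F u = u \<Longrightarrow> cluster_size u > 0"
proof -
  assume u: "poly F u = u"
  have "F - [:0, 1:] \<noteq> 0" using degree_fixed_poly deg by (metis degree_0 not_numeral_le_zero)
  hence "u \<in># filter_mset (\<lambda>r. r - u \<sqsubset> R) (proots (F - [:0, 1:]))"
    using u R_nonzero by simp
  thus ?thesis unfolding cluster_size_def nroots_def by (metis empty_iff nonempty_has_size set_mset_empty)
qed

lemma nroots_crit_cluster:
  assumes "poly F u = u"
  shows "Suc (nroots (pderiv F) u R) = cluster_size u"
proof -
  obtain e where e: "cluster_size u = Suc e"
    using cluster_size_pos[OF assms] by (cases "cluster_size u") auto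
  have "nroots (pderiv (F - [:u:])) u R = e"
    using dominant_cluster[OF assms fixed_le[OF assms]] R_nonzero e
    by (intro dominant_nroots_pderiv) auto
  thus ?thesis by (simp add: pderiv_diff pderiv_pCons e)
qed

section \<open>Components of preimages of discs\<close>

text \<open>
  \<^term>\<open>component z \<rho> e\<close>: the disc \<^term>\<open>{x. x - z \<sqsubset> \<rho>}\<close> is the connected component containing
  \<^term>\<open>z\<close> of the preimage of the disc \<^term>\<open>{y. y - poly F z \<sqsubset> R}\<close>, and \<^term>\<open>F\<close> maps the
  former onto the latter with degree \<^term>\<open>e\<close>.
\<close>

definition component :: "'a \<Rightarrow> 'a \<Rightarrow> nat \<Rightarrow> bool" where
  "component z \<rho> e \<longleftrightarrow> \<rho> \<noteq> 0 \<and> (let G = (F - [:poly F z:]) \<circ>\<^sub>p [:z, \<rho>:] in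
     dominant G e \<and> coeffs_le G R \<and> R \<sqsubseteq> coeff G e)"

lemma componentD:
  assumes "component z \<rho> e"
  shows "\<rho> \<noteq> 0" "dominant ((F - [:poly F z:]) \<circ>\<^sub>p [:z, \<rho>:]) e"
    "coeffs_le ((F - [:poly F z:]) \<circ>\<^sub>p [:z, \<rho>:]) R" "R \<sqsubseteq> coeff ((F - [:poly F z:]) \<circ>\<^sub>p [:z, \<rho>:]) e"
  using assms by (auto simp: component_def Let_def)

lemma component_degree_pos:
  assumes "component z \<rho> e"
  shows "e > 0"
proof (rule ccontr)
  assume "\<not> e > 0"
  hence "coeff ((F - [:poly F z:]) \<circ>\<^sub>p [:z, \<rho>:]) e = 0"
    by (simp)
  thus False using componentD(2)[OF assms] by (simp add: dominant_def)
qed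

text \<open>\<open>\<rho>\<close> is the largest radius at which all Taylor terms of
  \<open>F - [:poly F z:]\<close> at \<open>z\<close> stay within \<open>R\<close>, and
  \<open>e\<close> the first index attaining \<open>R\<close> there.\<close>

lemma exists_component: "\<exists>\<rho> e. component z \<rho> e"
proof -
  define T where "T = (F - [:poly F z:]) \<circ>\<^sub>p [:z, 1:]"
  define J where "J = {j. j \<le> degree F \<and> coeff T j \<noteq> 0}"
  have T0: "coeff T 0 = 0" by (simp add: T_def)
  have degT: "degree T = degree F" by (simp add: T_def degree_pcompose degree_minus_const)
  have "T \<noteq> 0" using degT deg by auto
  hence "lead_coeff T \<noteq> 0" by simp
  hence "degree F \<in> J" using degT by (simp add: J_def)
  \<comment> \<open>\<open>r j\<close> is the radius at which the term of index \<open>j\<close> has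
    size \<open>R\<close>; the least of these radii is the one sought.\<close>
  have "\<exists>r. r ^ j = R / coeff T j" if "j \<in> J" for j
    using that T0 by (intro nth_root_exists) (auto simp: J_def intro!: Nat.gr0I)
  then obtain r where r: "\<And>j. j \<in> J \<Longrightarrow> r j ^ j = R / coeff T j" by metis
  obtain i where i: "i \<in> J" "\<And>j. j \<in> J \<Longrightarrow> r i \<sqsubseteq> r j"
    using exists_minimal[of J r] \<open>degree F \<in> J\<close> by (auto simp: J_def)
  define \<rho> where "\<rho> = r i"
  have "i > 0" using i T0 by (auto simp: J_def intro!: Nat.gr0I)
  have "\<rho> \<noteq> 0" using r[OF i(1)] i(1) R_nonzero \<open>i > 0\<close> by (auto simp: \<rho>_def J_def zero_power)
  define G where "G = (F - [:poly F z:]) \<circ>\<^sub>p [:z, \<rho>:]"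
  have coeffG: "coeff G j = \<rho> ^ j * coeff T j" for j
    unfolding G_def by (subst pcompose_linear_split) (simp add: T_def coeff_pcompose_linear)
  have "coeff G j \<sqsubseteq> R" for j
  proof (cases "j \<in> J")
    case True
    have "\<rho> ^ j * coeff T j \<sqsubseteq> r j ^ j * coeff T j"
      unfolding \<rho>_def using i True by (intro le_mult_right le_power) auto
    thus ?thesis using True by (auto simp: r J_def coeffG)
  next
    case False
    hence "coeff T j = 0" using degT by (auto simp: J_def coeff_eq_0)
    thus ?thesis by (simp add: coeffG)
  qed
  hence le: "coeffs_le G R" by (simp add: coeffs_le_def)
  have Gi: "R \<sqsubseteq> coeff G i" using r[OF i(1)] i(1) by (auto simp: coeffG \<rho>_def J_def)
  define e where "e = (LEAST e. R \<sqsubseteq> coeff G e)"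
  have e: "R \<sqsubseteq> coeff G e" unfolding e_def using Gi by (rule LeastI)
  have "coeff G j \<sqsubset> R" if "j < e" for j
    using that not_less_Least unfolding e_def lt_def by blast
  hence "dominant G e" using e le R_nonzero by (intro dominantI[of R]) auto
  thus ?thesis using \<open>\<rho> \<noteq> 0\<close> le e unfolding component_def G_def Let_def by blast
qed

lemma component_radius:
  assumes "component z \<rho> e"
  shows "\<rho> \<sqsubset> R"
proof (rule ccontr)
  assume "\<not> \<rho> \<sqsubset> R"
  hence "R \<sqsubseteq> \<rho>" by (simp add: not_lt)
  let ?G = "(F - [:poly F z:]) \<circ>\<^sub>p [:z, \<rho>:]"
  have "lead_coeff ?G = \<rho> ^ degree F"
    using degree_minus_const componentD(1)[OF assms] by (subst lead_coeff_comp) simp_all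
  hence "\<rho> ^ degree F \<sqsubseteq> R"
    using componentD(3)[OF assms] unfolding coeffs_le_def by metis
  moreover have "R ^ degree F \<sqsubseteq> \<rho> ^ degree F"
    using \<open>R \<sqsubseteq> \<rho>\<close> by (rule le_power)
  ultimately show False using R_lt_power unfolding lt_def using le_trans by blast
qed

lemma component_image:
  assumes "component z \<rho> e" "x - z \<sqsubset> \<rho>"
  shows "poly F x - poly F z \<sqsubset> R"
proof -
  let ?G = "(F - [:poly F z:]) \<circ>\<^sub>p [:z, \<rho>:]"
  have "poly ?G ((x - z) / \<rho>) \<sqsubset> R"
    using componentD[OF assms(1)] assms(2) R_nonzero by (intro poly_lt) (auto simp: lt_divide)
  thus ?thesis using componentD(1)[OF assms(1)] by (simp add: poly_pcompose)
qed

text \<open>Moving the target by less than \<open>R\<close> changes only the constant term, and by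
  less than the Gauss norm.\<close>

lemma component_nroots:
  assumes "component z \<rho> e" "w - poly F z \<sqsubset> R"
  shows "nroots (F - [:w:]) z \<rho> = e"
proof (rule nroots_eqI)
  note comp = componentD[OF assms(1)]
  let ?G = "(F - [:poly F z:]) \<circ>\<^sub>p [:z, \<rho>:]"
  have "coeff [:poly F z - w:] j \<sqsubset> coeff ?G e" for j
    using lt_le_trans[OF assms(2) comp(4)] comp(2)
    by (auto simp: coeff_pCons dominant_def lt_diff_commute[of w] split: nat.splits)
  with comp(2) have "dominant (?G + [:poly F z - w:]) e"
    by (rule dominant_add)
  moreover have "?G + [:poly F z - w:] = (F - [:w:]) \<circ>\<^sub>p [:z, \<rho>:]"
    by (simp add: pcompose_diff)
  ultimately show "dominant ((F - [:w:]) \<circ>\<^sub>p [:z, \<rho>:]) e" by simp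
  show "\<rho> \<noteq> 0" by (rule comp)
qed

lemma component_nroots_crit:
  assumes "component z \<rho> (Suc e)"
  shows "nroots (pderiv F) z \<rho> = e"
  using dominant_nroots_pderiv[OF componentD(2,1)[OF assms]] by (simp add: pderiv_diff pderiv_pCons)

text \<open>A component of degree 1 has no critical points, so the derivative has constant absolute
  value on it, that of \<open>R / \<rho>\<close>.\<close>

lemma component_1_deriv:
  assumes "component z \<rho> (Suc 0)" "x - z \<sqsubset> \<rho>"
  shows "R \<sqsubseteq> poly (pderiv F) x * \<rho>" "poly (pderiv F) x * \<rho> \<sqsubseteq> R"
proof -
  note comp = componentD[OF assms(1)]
  let ?G = "(F - [:poly F z:]) \<circ>\<^sub>p [:z, \<rho>:]"
  have 0: "coeff (pderiv ?G) 0 = coeff ?G 1" by (simp add: coeff_pderiv)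
  have 1: "poly (pderiv ?G) ((x - z) / \<rho>) = poly (pderiv F) x * \<rho>"
    using comp(1) by (subst poly_pderiv_pcompose_linear) (simp add: pderiv_diff pderiv_pCons)
  have 2: "(x - z) / \<rho> \<sqsubset> 1" using assms comp(1) by (simp add: lt_divide)
  have "R \<sqsubseteq> coeff ?G 1" "coeff ?G 1 \<sqsubseteq> R"
    using comp(3,4) by (simp_all add: coeffs_le_def)
  thus "R \<sqsubseteq> poly (pderiv F) x * \<rho>" "poly (pderiv F) x * \<rho> \<sqsubseteq> R"
    using poly_dominant_0[OF dominant_pderiv[OF comp(2)] 2] le_trans unfolding 0 1 by blast+
qed

text \<open>\<open>F\<close> maps the disc of radius \<open>\<rho>\<close> bijectively onto a disc
  of larger radius \<open>R\<close> containing it. Hence it has a fixed point in the small disc, and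
  its multiplier has the size of \<open>R / \<rho>\<close>, which exceeds 1.\<close>

lemma component_1_repelling:
  assumes "component z \<rho> (Suc 0)" "poly F z - z \<sqsubset> R"
  shows "\<exists>x. poly F x = x \<and> 1 \<sqsubset> poly (pderiv F) x"
proof -
  note comp = componentD[OF assms(1)]
  let ?G = "(F - [:poly F z:]) \<circ>\<^sub>p [:z, \<rho>:]"
  have \<rho>: "\<rho> \<sqsubset> R" by (rule component_radius) fact
  have "coeff [:poly F z - z, -\<rho>:] j \<sqsubset> coeff ?G (Suc 0)" for j
    using lt_le_trans[OF assms(2) comp(4)] lt_le_trans[OF \<rho> comp(4)] comp(2)
    by (auto simp: coeff_pCons dominant_def split: nat.splits)
  with comp(2) have "dominant (?G + [:poly F z - z, -\<rho>:]) (Suc 0)"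
    by (rule dominant_add)
  also have "?G + [:poly F z - z, -\<rho>:] = (F - [:0, 1:]) \<circ>\<^sub>p [:z, \<rho>:]"
    by (simp add: pcompose_diff pcompose_pCons)
  finally obtain y where y: "y \<sqsubset> 1" "poly (F - [:0, 1:]) (z + \<rho> * y) = 0"
    using comp(1) by (elim dominant_Suc_0_root) auto
  have "(z + \<rho> * y) - z \<sqsubset> \<rho>" using y comp(1) lt_mult'[of \<rho> \<rho> y 1] by simp
  from component_1_deriv(1)[OF assms(1) this] have "\<rho> * 1 \<sqsubset> poly (pderiv F) (z + \<rho> * y) * \<rho>"
    using \<rho> lt_le_trans by simp
  hence "1 \<sqsubset> poly (pderiv F) (z + \<rho> * y)"
    using lt_mult_cancel[of \<rho> 1 "poly (pderiv F) (z + \<rho> * y)"] comp(1) by simp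
  thus ?thesis using y by (intro exI[of _ "z + \<rho> * y"]) auto
qed

lemma component_radius_maximal:
  assumes "component z \<rho> e" "coeffs_le ((F - [:poly F z:]) \<circ>\<^sub>p [:z, \<sigma>:]) R"
  shows "\<sigma> \<sqsubseteq> \<rho>"
proof (rule ccontr)
  assume "\<not> \<sigma> \<sqsubseteq> \<rho>"
  hence "\<rho> \<sqsubset> \<sigma>" by (simp add: not_le)
  note comp = componentD[OF assms(1)]
  define T where "T = (F - [:poly F z:]) \<circ>\<^sub>p [:z, 1:]"
  have coeff: "coeff ((F - [:poly F z:]) \<circ>\<^sub>p [:z, \<rho>:]) e = \<rho> ^ e * coeff T e" for \<rho>
    by (subst pcompose_linear_split) (simp add: T_def coeff_pcompose_linear)
  have "coeff T e \<noteq> 0" using comp(2) by (auto simp: dominant_def coeff)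
  hence "\<rho> ^ e * coeff T e \<sqsubset> \<sigma> ^ e * coeff T e"
    using \<open>\<rho> \<sqsubset> \<sigma>\<close> component_degree_pos[OF assms(1)] by (simp add: lt_mult_cancel lt_power)
  moreover have "R \<sqsubseteq> \<rho> ^ e * coeff T e" using comp(4) coeff by simp
  moreover have "\<sigma> ^ e * coeff T e \<sqsubseteq> R" using assms(2) coeff unfolding coeffs_le_def by metis
  ultimately show False using le_trans lt_def by blast
qed

lemma component_recentre:
  assumes "component z \<rho> e" "poly F z' = poly F z" "z' - z \<sqsubseteq> \<rho>"
  shows "coeffs_le ((F - [:poly F z':]) \<circ>\<^sub>p [:z', \<rho>:]) R"
proof -
  note comp = componentD[OF assms(1)]
  have "[:z', \<rho>:] = [:z, \<rho>:] \<circ>\<^sub>p [:(z' - z) / \<rho>, 1:]"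
    using comp(1) by (simp add: pcompose_pCons)
  hence "(F - [:poly F z':]) \<circ>\<^sub>p [:z', \<rho>:] =
      ((F - [:poly F z:]) \<circ>\<^sub>p [:z, \<rho>:]) \<circ>\<^sub>p [:(z' - z) / \<rho>, 1:]"
    using assms(2) by (simp add: pcompose_assoc)
  moreover have "coeffs_le [:(z' - z) / \<rho>, 1:] 1"
    using assms(3) comp(1) by (auto simp: coeffs_le_def coeff_pCons le_divide split: nat.splits)
  ultimately show ?thesis using comp(3) coeffs_le_pcompose by simp
qed

text \<open>Of two intersecting discs the smaller has its centre in the larger. Recentring the
  larger one there and applying \<open>component_radius_maximal\<close> shows that the radii
  agree.\<close>

lemma component_disc_eq:
  assumes "component z \<rho> e" "component z' \<rho>' e'" "poly F z = poly F z'"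
    and "x - z \<sqsubset> \<rho>" "x - z' \<sqsubset> \<rho>'"
  shows "{y. y - z \<sqsubset> \<rho>} = {y. y - z' \<sqsubset> \<rho>'}"
proof -
  have *: "{y. y - z \<sqsubset> \<rho>} = {y. y - z' \<sqsubset> \<rho>'}"
    if "component z \<rho> e" "component z' \<rho>' e'" "poly F z = poly F z'"
      "x - z \<sqsubset> \<rho>" "x - z' \<sqsubset> \<rho>'" "\<rho> \<sqsubseteq> \<rho>'" for z z' \<rho> \<rho>' e e'
  proof -
    have "(x - z') - (x - z) \<sqsubset> \<rho>'"
      using that(5) lt_le_trans[OF that(4,6)] by (rule lt_diff)
    hence zz': "z - z' \<sqsubset> \<rho>'" by simp
    have "\<rho>' \<sqsubseteq> \<rho>"
      using component_radius_maximal[OF that(1) component_recentre[OF that(2,3)]] zz' lt_imp_le by blast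
    have "y - z' \<sqsubset> \<rho>'" if "y - z \<sqsubset> \<rho>" for y
      using lt_add[OF lt_le_trans[OF that \<open>\<rho> \<sqsubseteq> \<rho>'\<close>] zz'] by simp
    moreover have "y - z \<sqsubset> \<rho>" if "y - z' \<sqsubset> \<rho>'" for y
      using lt_le_trans[OF lt_diff[OF that zz'] \<open>\<rho>' \<sqsubseteq> \<rho>\<close>] by simp
    ultimately show ?thesis by blast
  qed
  show ?thesis
    using le_total[of \<rho> \<rho>'] *[OF assms] *[OF assms(2,1) assms(3)[symmetric] assms(5,4)] by blast
qed


text \<open>The components over \<open>w\<close> in the cluster are disjoint, so
  \<open>size_le_cover\<close> reduces the estimate to a single one. It contains \<open>e\<close> of
  the \<open>cluster_size u\<close> preimages of \<open>w\<close>, and its critical points lie in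
  the cluster and over the disc about \<open>w\<close>.\<close>

lemma cluster_size_le_crit:
  assumes u: "poly F u = u" and w: "w \<sqsubseteq> R"
    and e: "\<And>b \<rho> e. component b \<rho> e \<Longrightarrow> poly F b = w \<Longrightarrow> b - u \<sqsubset> R \<Longrightarrow> e \<ge> 2"
  shows "cluster_size u \<le> 2 * size (filter_mset (\<lambda>c. c - u \<sqsubset> R \<and> poly F c - w \<sqsubset> R) crit)"
proof -
  let ?F = "{V. \<exists>b \<rho> e. component b \<rho> e \<and> poly F b = w \<and> V = {x. x - b \<sqsubset> \<rho>}}"
  let ?B = "filter_mset (\<lambda>r. r - u \<sqsubset> R) (proots (F - [:w:]))"
  let ?C = "filter_mset (\<lambda>c. c - u \<sqsubset> R \<and> poly F c - w \<sqsubset> R) crit"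
  have "size ?B \<le> 2 * size ?C"
  proof (rule size_le_cover[where F = ?F])
    fix V W assume "V \<in> ?F" "W \<in> ?F"
    then obtain b \<rho> e b' \<rho>' e' where *: "component b \<rho> e" "component b' \<rho>' e'"
      "poly F b = poly F b'" "V = {x. x - b \<sqsubset> \<rho>}" "W = {x. x - b' \<sqsubset> \<rho>'}" by auto
    show "V = W \<or> V \<inter> W = {}"
      using component_disc_eq[OF *(1-3)] unfolding *(4,5) by blast
  next
    fix b assume b: "b \<in># ?B"
    hence b: "poly F b = w" "b - u \<sqsubset> R" using degree_minus_const(3) by auto
    obtain \<rho> e where comp: "component b \<rho> e" using exists_component by blast
    obtain k where k: "e = Suc (Suc k)"
      using e[OF comp b] by (metis add_2_eq_Suc le_Suc_ex)
    let ?V = "{x. x - b \<sqsubset> \<rho>}"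
    have V: "x - u \<sqsubset> R" "poly F x - w \<sqsubset> R" if "x - b \<sqsubset> \<rho>" for x
      using component_image[OF comp that] b lt_add[OF lt_trans[OF that component_radius[OF comp]] b(2)]
      by simp_all
    have "filter_mset (\<lambda>x. x \<in> ?V) ?B = filter_mset (\<lambda>r. r - b \<sqsubset> \<rho>) (proots (F - [:w:]))"
      by (auto simp: filter_filter_mset V intro!: filter_mset_cong)
    hence 1: "size (filter_mset (\<lambda>x. x \<in> ?V) ?B) = e"
      using component_nroots[OF comp, of w] b R_nonzero by (simp add: nroots_def)
    have "filter_mset (\<lambda>x. x \<in> ?V) ?C = filter_mset (\<lambda>r. r - b \<sqsubset> \<rho>) crit"
      by (auto simp: filter_filter_mset V intro!: filter_mset_cong)
    hence 2: "size (filter_mset (\<lambda>x. x \<in> ?V) ?C) = Suc k"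
      using component_nroots_crit[of b \<rho> "Suc k"] comp by (simp add: nroots_def k)
    \<comment> \<open>Riemann-Hurwitz: a component of degree \<open>e\<close> contains \<open>e - 1\<close> critical points, and \<open>e \<le> 2 * (e - 1)\<close>.\<close>
    show "\<exists>V\<in>?F. b \<in> V \<and> size (filter_mset (\<lambda>x. x \<in> V) ?B) \<le> 2 * size (filter_mset (\<lambda>x. x \<in> V) ?C)"
      using comp b 1 2 k R_nonzero componentD(1)[OF comp] by (intro bexI[of _ ?V]) auto
  qed
  moreover have "size ?B = cluster_size u"
    using nroots_cluster[OF u w] by (simp add: nroots_def)
  ultimately show ?thesis by simp
qed

section \<open>Distribution of the critical points in the absence of repelling fixed points\<close>

context
  assumes fixed_multiplier: "\<And>x. poly F x = x \<Longrightarrow> poly (pderiv F) x \<sqsubseteq> 1"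
begin

text \<open>A component of degree 1 in the cluster of \<open>u\<close> and over that same cluster
  would contain a repelling fixed point.\<close>

lemma cluster_size_le_crit_self:
  assumes u: "poly F u = u"
  shows "cluster_size u \<le> 2 * size (filter_mset (\<lambda>c. c - u \<sqsubset> R \<and> poly F c - u \<sqsubset> R) crit)"
proof (rule cluster_size_le_crit[OF u fixed_le[OF u]])
  fix b \<rho> e assume b: "component b \<rho> e" "poly F b = u" "b - u \<sqsubset> R"
  have "poly F b - b \<sqsubset> R" using b(2,3) lt_diff_commute by simp
  hence "e \<noteq> Suc 0"
    using component_1_repelling[of b \<rho>] b(1) fixed_multiplier unfolding lt_def by blast
  thus "e \<ge> 2" using component_degree_pos[OF b(1)] by simp
qed

text \<open>A cluster of size m has m - 1 critical points, and m <= 2 (m - 1) forces m >= 2.\<close>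

lemma cluster_size_ge_2:
  assumes u: "poly F u = u"
  shows "cluster_size u \<ge> 2"
proof -
  have "size (filter_mset (\<lambda>c. c - u \<sqsubset> R \<and> poly F c - u \<sqsubset> R) crit) \<le> nroots (pderiv F) u R"
    unfolding nroots_def by (intro size_mset_mono) (auto simp: subseteq_mset_def)
  thus ?thesis
    using cluster_size_le_crit_self[OF u] nroots_crit_cluster[OF u] by simp
qed

text \<open>Of the m - 1 critical points in the cluster at least m/2 lie over the cluster itself. If
  all components over \<open>w\<close> had degree at least 2, another m/2 would lie over the disc
  about \<open>w\<close>, which is disjoint from the cluster by
  \<open>R \<sqsubseteq> w - u\<close>.\<close>

lemma exists_univalent_component:
  assumes u: "poly F u = u" and w: "w \<sqsubseteq> R" "R \<sqsubseteq> w - u"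
  shows "\<exists>b \<rho>. component b \<rho> (Suc 0) \<and> poly F b = w \<and> b - u \<sqsubset> R"
proof (rule ccontr)
  assume none: "\<not> ?thesis"
  have "e \<ge> 2" if "component b \<rho> e" "poly F b = w" "b - u \<sqsubset> R" for b \<rho> e
    using none that component_degree_pos[OF that(1)]
    by (metis One_nat_def Suc_leI le_neq_implies_less numeral_2_eq_2)
  hence 1: "cluster_size u \<le> 2 * size (filter_mset (\<lambda>c. c - u \<sqsubset> R \<and> poly F c - w \<sqsubset> R) crit)"
    by (rule cluster_size_le_crit[OF u w(1)])
  have "filter_mset (\<lambda>c. c - u \<sqsubset> R \<and> poly F c - w \<sqsubset> R) crit +
     filter_mset (\<lambda>c. c - u \<sqsubset> R \<and> poly F c - u \<sqsubset> R) crit \<subseteq># filter_mset (\<lambda>c. c - u \<sqsubset> R) crit"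
  proof -
    have disj: "\<not> (poly F c - w \<sqsubset> R \<and> poly F c - u \<sqsubset> R)" for c
    proof
      assume "poly F c - w \<sqsubset> R \<and> poly F c - u \<sqsubset> R"
      hence "(poly F c - u) - (poly F c - w) \<sqsubset> R" using lt_diff by blast
      thus False using w(2) by (simp add: lt_def)
    qed
    show ?thesis using disj by (auto simp: subseteq_mset_def)
  qed
  from size_mset_mono[OF this] have
    "size (filter_mset (\<lambda>c. c - u \<sqsubset> R \<and> poly F c - w \<sqsubset> R) crit) +
     size (filter_mset (\<lambda>c. c - u \<sqsubset> R \<and> poly F c - u \<sqsubset> R) crit) \<le> nroots (pderiv F) u R"
    by (simp add: nroots_def)
  thus False
    using 1 cluster_size_le_crit_self[OF u] nroots_crit_cluster[OF u] by linarith
qed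

end

end

section \<open>The repelling cycle of period 2\<close>

context spread_fixed_points
begin

context
  assumes fixed_multiplier: "\<And>x. poly F x = x \<Longrightarrow> poly (pderiv F) x \<sqsubseteq> 1"
    and fixed_0: "poly F 0 = 0" and fixed_R: "poly F R = R"
begin

lemma degree_ge_4: "degree F \<ge> 4"
proof -
  let ?P = "F - [:0, 1:]"
  have disj: "\<not> (r - 0 \<sqsubset> R \<and> r - R \<sqsubset> R)" for r
    using lt_diff[of "r - 0" R "r - R"] by auto
  have "filter_mset (\<lambda>r. r - 0 \<sqsubset> R) (proots ?P) + filter_mset (\<lambda>r. r - R \<sqsubset> R) (proots ?P) \<subseteq># proots ?P"
    using disj by (auto simp: subseteq_mset_def)
  from size_mset_mono[OF this] have "cluster_size 0 + cluster_size R \<le> size (proots ?P)"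
    by (simp add: cluster_size_def nroots_def)
  also have "\<dots> \<le> degree F"
    using size_proots_le[of ?P] degree_fixed_poly by simp
  finally show ?thesis
    using cluster_size_ge_2[OF fixed_multiplier fixed_0] cluster_size_ge_2[OF fixed_multiplier fixed_R]
    by simp
qed

text \<open>A component of degree 1 in the cluster of 0 is mapped onto the disc about
  \<open>b\<close>, and one about \<open>b\<close> in the cluster of \<open>R\<close> onto the disc
  about 0. The composite expands a small disc about \<open>z\<close> onto a disc of radius
  \<open>R\<close> containing it, which gives a repelling periodic point.\<close>

lemma exists_repelling_2_cycle:
  "\<exists>z. poly F (poly F z) = z \<and> poly F z \<noteq> z \<and> 1 \<sqsubset> poly (pderiv F) z * poly (pderiv F) (poly F z)"
proof -
  obtain b \<tau> where b: "component b \<tau> (Suc 0)" "poly F b = 0" "b - R \<sqsubset> R"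
    using exists_univalent_component[OF fixed_multiplier fixed_R, of 0] by auto
  \<comment> \<open>As \<open>b\<close> lies in the open disc of radius \<open>R\<close> about
    \<open>R\<close>, it has the absolute value of \<open>R\<close>, which is the distance from 0
    required of the target in \<open>exists_univalent_component\<close>.\<close>
  have bR: "b \<sqsubseteq> R" "R \<sqsubseteq> b"
    using le_add[of "b - R" R R] lt_imp_le[OF b(3)] lt_diff[of b R "b - R"] b(3) not_lt by auto
  obtain z \<rho> where z: "component z \<rho> (Suc 0)" "poly F z = b" "z - 0 \<sqsubset> R"
    using exists_univalent_component[OF fixed_multiplier fixed_0, of b] bR by auto
  note b_comp = componentD[OF b(1)] and z_comp = componentD[OF z(1)]
  have z_deriv: "R \<sqsubseteq> poly (pderiv F) z * \<rho>" and b_deriv: "R \<sqsubseteq> poly (pderiv F) b * \<tau>"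
    using component_1_deriv(1)[OF z(1), of z] component_1_deriv(1)[OF b(1), of b] b_comp(1) z_comp(1)
    by auto
  let ?a = "poly (pderiv F) z"
  have a: "?a \<noteq> 0" using z_deriv le_zero R_nonzero by auto
  \<comment> \<open>The radius of the disc about \<open>z\<close> that \<open>F\<close> maps onto
    the disc of radius \<open>\<tau>\<close> about \<open>b\<close>, the derivative having the
    absolute value of \<open>?a\<close> on the component of \<open>z\<close>.\<close>
  define \<sigma> where "\<sigma> = \<tau> / ?a"
  have \<sigma>_nz: "\<sigma> \<noteq> 0" using b_comp a by (simp add: \<sigma>_def)
  have "\<sigma> * ?a \<sqsubset> \<rho> * ?a"
    using lt_le_trans[OF component_radius[OF b(1)] z_deriv] a by (simp add: \<sigma>_def mult.commute)
  hence "\<sigma> \<sqsubset> \<rho>" using a lt_mult_cancel by blast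
  hence \<sigma>R: "\<sigma> \<sqsubset> R" using component_radius[OF z(1)] lt_trans by blast
  \<comment> \<open>\<open>F \<circ> F\<close> near \<open>z\<close> in coordinates in which the discs of radii \<open>\<sigma>\<close> and \<open>\<tau>\<close> are the unit disc.\<close>
  define H where "H = F \<circ>\<^sub>p [:b, \<tau>:]"
  define Y where "Y = smult (inverse \<tau>) ((F - [:b:]) \<circ>\<^sub>p [:z, \<sigma>:])"
  define Q where "Q = H \<circ>\<^sub>p Y"
  have H_le: "coeffs_le H R"
    using b_comp(3) b(2) by (simp add: H_def)
  have poly_Y: "poly Y x = (poly F (z + \<sigma> * x) - b) / \<tau>" for x
    by (simp add: Y_def poly_pcompose field_simps)
  have deriv_Y: "poly (pderiv Y) x = poly (pderiv F) (z + \<sigma> * x) * \<sigma> / \<tau>" for x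
    unfolding Y_def by (simp add: pderiv_smult poly_pderiv_pcompose_linear pderiv_diff pderiv_pCons field_simps)
  have poly_Q: "poly Q x = poly F (poly F (z + \<sigma> * x))" for x
    using b_comp(1) by (simp add: Q_def H_def poly_pcompose poly_Y)
  have deriv_Q: "poly (pderiv Q) x =
      poly (pderiv F) (z + \<sigma> * x) * poly (pderiv F) (poly F (z + \<sigma> * x)) * \<sigma>" for x
    using b_comp(1) unfolding Q_def H_def
    by (simp add: pderiv_pcompose poly_pcompose pderiv_pCons poly_Y deriv_Y)
  \<comment> \<open>At radius \<open>\<rho>\<close> every term of positive index is at most
    \<open>?a * \<rho>\<close>. Shrinking the radius to \<open>\<sigma>\<close> gains at least a
    factor \<open>\<sigma> / \<rho>\<close>, which leaves at most \<open>?a * \<sigma>\<close>, that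
    is, \<open>\<tau>\<close>.\<close>
  have Y_le: "coeffs_le Y 1"
    unfolding coeffs_le_def
  proof
    fix j
    let ?T = "(F - [:b:]) \<circ>\<^sub>p [:z, 1:]"
    have coeff: "coeff ((F - [:b:]) \<circ>\<^sub>p [:z, r:]) j = r ^ j * coeff ?T j" for r
      by (subst pcompose_linear_split) (simp add: coeff_pcompose_linear)
    show "coeff Y j \<sqsubseteq> 1"
    proof (cases "j = 0")
      case True
      thus ?thesis using z by (simp add: Y_def)
    next
      case False
      then obtain k where k: "j = Suc k" by (cases j) auto
      have "\<sigma> / \<rho> \<sqsubseteq> 1" using \<open>\<sigma> \<sqsubset> \<rho>\<close> z_comp(1) lt_imp_le by (simp add: le_divide)
      from le_mult_right[OF power_le_one[OF this, of k], of "\<sigma> / \<rho>"]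
      have "(\<sigma> / \<rho>) ^ j \<sqsubseteq> \<sigma> / \<rho>" by (simp add: k mult.commute)
      moreover have "\<rho> ^ j * coeff ?T j \<sqsubseteq> ?a * \<rho>"
        using z_comp(3) z(2) coeff[of \<rho>] z_deriv le_trans unfolding coeffs_le_def by metis
      ultimately have "(\<rho> ^ j * coeff ?T j) * (\<sigma> / \<rho>) ^ j \<sqsubseteq> (?a * \<rho>) * (\<sigma> / \<rho>)"
        by (rule le_mult[rotated])
      moreover have "(\<rho> ^ j * coeff ?T j) * (\<sigma> / \<rho>) ^ j = coeff ((F - [:b:]) \<circ>\<^sub>p [:z, \<sigma>:]) j"
        using z_comp(1) by (simp add: coeff[of \<sigma>] power_divide)
      moreover have "(?a * \<rho>) * (\<sigma> / \<rho>) = \<tau>"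
        using z_comp(1) a by (simp add: \<sigma>_def)
      ultimately have "coeff ((F - [:b:]) \<circ>\<^sub>p [:z, \<sigma>:]) j \<sqsubseteq> \<tau>" by simp
      hence "coeff ((F - [:b:]) \<circ>\<^sub>p [:z, \<sigma>:]) j / \<tau> \<sqsubseteq> 1"
        using b_comp(1) by (simp add: le_divide)
      thus ?thesis by (simp add: Y_def divide_inverse mult.commute)
    qed
  qed
  have Q_le: "coeffs_le Q R"
    unfolding Q_def using H_le Y_le by (rule coeffs_le_pcompose)
  have Q0: "coeff Q 0 = 0"
    using poly_Q[of 0] z b by (simp add: poly_0_coeff_0)
  have "coeff (pderiv Q) 0 = poly (pderiv F) b * \<tau>"
    using deriv_Q[of 0] z a b_comp(1) by (simp add: poly_0_coeff_0 \<sigma>_def)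
  hence Q1: "R \<sqsubseteq> coeff Q (Suc 0)"
    using b_deriv by (simp add: coeff_pderiv)
  \<comment> \<open>Both coefficients of \<open>[:z, \<sigma>:]\<close> are smaller than
    \<open>R\<close>, so subtracting it from \<open>Q\<close> leaves the linear term dominant: one
    point of the disc is fixed by the second iterate.\<close>
  have "dominant (Q - [:z, \<sigma>:]) (Suc 0)"
  proof (rule dominantI[OF R_nonzero])
    show "coeffs_le (Q - [:z, \<sigma>:]) R"
      using z(3) \<sigma>R Q_le
      by (intro coeffs_le_diff) (auto simp: coeffs_le_def coeff_pCons lt_imp_le split: nat.splits)
    show "R \<sqsubseteq> coeff (Q - [:z, \<sigma>:]) (Suc 0)"
      using le_add_of_lt[OF Q1, of "-\<sigma>"] \<sigma>R by simp
  qed (use Q0 z(3) in simp)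
  then obtain x where "x \<sqsubset> 1" "poly (Q - [:z, \<sigma>:]) (0 + 1 * x) = 0"
    using dominant_Suc_0_root[of "Q - [:z, \<sigma>:]" 0 1] by (metis pcompose_idR zero_neq_one)
  hence x: "x \<sqsubset> 1" "poly F (poly F (z + \<sigma> * x)) = z + \<sigma> * x"
    by (simp_all add: poly_Q mult.commute)
  let ?y = "z + \<sigma> * x"
  have "dominant Q (Suc 0)"
    using R_nonzero Q_le Q0 Q1 by (intro dominantI[of R]) auto
  hence "coeff (pderiv Q) 0 \<sqsubseteq> poly (pderiv Q) x"
    by (intro poly_dominant_0 dominant_pderiv x)
  hence "R \<sqsubseteq> poly (pderiv F) ?y * poly (pderiv F) (poly F ?y) * \<sigma>"
    using le_trans[OF Q1] by (simp add: coeff_pderiv deriv_Q)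
  hence "1 * \<sigma> \<sqsubset> poly (pderiv F) ?y * poly (pderiv F) (poly F ?y) * \<sigma>"
    using \<sigma>R lt_le_trans by simp
  hence "1 \<sqsubset> poly (pderiv F) ?y * poly (pderiv F) (poly F ?y)"
    using \<sigma>_nz lt_mult_cancel by blast
  \<comment> \<open>\<open>poly F ?y\<close> lies in the open disc of radius \<open>R\<close> about
    \<open>b\<close> and \<open>?y\<close> in the one about 0; these are disjoint.\<close>
  moreover have "poly F ?y \<noteq> ?y"
  proof
    assume eq: "poly F ?y = ?y"
    have "(poly F ?y - b) / \<tau> \<sqsubseteq> 1"
      using poly_le[OF Y_le lt_imp_le[OF x(1)]] by (simp add: poly_Y)
    hence "?y - b \<sqsubseteq> \<tau>" using b_comp(1) by (simp add: le_divide eq)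
    from le_lt_trans[OF this component_radius[OF b(1)]] have "?y - b \<sqsubset> R" .
    moreover have "\<sigma> * x \<sqsubset> \<sigma>" using lt_mult'[of \<sigma> \<sigma> x 1] x \<sigma>_nz by simp
    from lt_trans[OF this \<sigma>R] have "?y \<sqsubset> R" using z(3) by (intro lt_add) auto
    ultimately have "?y - (?y - b) \<sqsubset> R" using lt_diff by blast
    thus False using bR(2) by (simp add: lt_def)
  qed
  ultimately show ?thesis using x(2) by blast
qed

end

end

lemma proots_prod_linear: "proots (\<Prod>x\<in>#A. [:-x, 1:]) = (A :: 'a :: idom multiset)"
proof (induction A)
  case (add x A)
  have "(\<Prod>x\<in>#A. [:-x, 1:]) \<noteq> 0" by (auto simp: prod_mset_zero_iff)
  hence "proots ([:-x, 1:] * (\<Prod>x\<in>#A. [:-x, 1:])) = {#x#} + A"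
    by (subst proots_mult) (simp_all add: add.IH del: mult_pCons_left)
  thus ?case by simp
qed simp

section \<open>Integrality of fixed and critical points\<close>

context valuation_preorder
begin

text \<open>If some fixed point is not integral, one of largest absolute value serves as
  \<open>R\<close>, and a repelling cycle of period 2 appears. Assuming \<open>cycle\<close> only
  from degree 4 on is what later gives the sharper result in degrees 2 and 3.\<close>

lemma fixed_points_le_one:
  assumes "lead_coeff F = 1" "degree F \<ge> 2" "poly F 0 = 0"
    and fixed: "\<And>x. poly F x = x \<Longrightarrow> poly (pderiv F) x \<sqsubseteq> 1"
    and cycle: "degree F \<ge> 4 \<Longrightarrow> (\<And>x. poly F (poly F x) = x \<Longrightarrow> poly F x \<noteq> x \<Longrightarrow>
                  poly (pderiv F) x * poly (pderiv F) (poly F x) \<sqsubseteq> 1)"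
    and a: "poly F a = a"
  shows "a \<sqsubseteq> 1"
proof (rule ccontr)
  assume "\<not> a \<sqsubseteq> 1"
  have "F - [:0, 1:] \<noteq> 0"
    using degree_diff_less(1)[of "[:0, 1:]" F] assms(2) by auto
  hence "finite {x. poly (F - [:0, 1:]) x = 0}" by (rule poly_roots_finite)
  hence "finite {x. poly F x = x}" by simp
  then obtain R where R: "poly F R = R" "\<And>x. poly F x = x \<Longrightarrow> x \<sqsubseteq> R"
    using exists_maximal[of "{x. poly F x = x}" "\<lambda>x. x"] a by auto
  have "1 \<sqsubset> R" using R(2)[OF a] \<open>\<not> a \<sqsubseteq> 1\<close> le_trans unfolding lt_def by blast
  interpret spread_fixed_points le F R
    by unfold_locales (use assms R \<open>1 \<sqsubset> R\<close> in auto)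
  have "degree F \<ge> 4" using degree_ge_4 fixed assms(3) R(1) by blast
  from cycle[OF this] show False
    using exists_repelling_2_cycle[OF fixed assms(3) R(1)] unfolding lt_def by blast
qed

text \<open>If |c| > 1, all fixed points lie in the open disc of radius |c|. By Rouche
  \<open>F\<close> has as many zeros there as \<open>F - [:0, 1:]\<close>, namely
  \<open>degree F\<close>, so all \<open>degree F - 1\<close> critical points lie in that disc,
  whereas \<open>c\<close> does not.\<close>

lemma critical_points_le_one:
  assumes "lead_coeff F = 1" "degree F \<ge> 2"
    and fixed: "\<And>x. poly F x = x \<Longrightarrow> x \<sqsubseteq> 1"
    and c: "poly (pderiv F) c = 0"
  shows "c \<sqsubseteq> 1"
proof (rule ccontr)
  assume "\<not> c \<sqsubseteq> 1"
  hence "1 \<sqsubset> c" by (simp add: lt_def)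
  hence nz: "c \<noteq> 0" by (rule lt_imp_nonzero)
  let ?P = "F - [:0, 1:]"
  have P: "degree ?P = degree F" "lead_coeff ?P = 1" "?P \<noteq> 0"
    using degree_diff_less[of "[:0, 1:]" F] assms by auto
  obtain n where n: "degree F = Suc (Suc n)"
    using assms(2) by (metis add_2_eq_Suc le_Suc_ex)
  obtain A where A: "size A = degree ?P" "?P = (\<Prod>x\<in>#A. [:-x, 1:])"
    using alg_closed_imp_factorization[OF P(3)] P(2) by auto
  have roots: "proots ?P = A"
    unfolding A(2) by (rule proots_prod_linear)
  have "r - 0 \<sqsubset> c" if "r \<in># A" for r
  proof -
    have "r \<in># proots ?P" using that roots by simp
    hence "poly F r = r" using P(3) by simp
    from le_lt_trans[OF fixed[OF this] \<open>1 \<sqsubset> c\<close>] show ?thesis by simp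
  qed
  hence "filter_mset (\<lambda>r. r - 0 \<sqsubset> c) A = A"
    by (subst filter_mset_eq_conv) auto
  hence "nroots ?P 0 c = degree F"
    using A(1) P(1) unfolding nroots_def roots by simp
  hence dom: "dominant (?P \<circ>\<^sub>p [:0, c:]) (degree F)"
    using dominant_nroots[OF P(3) nz, of 0] by simp
  have "coeff [:0, c:] j \<sqsubset> coeff (?P \<circ>\<^sub>p [:0, c:]) (degree F)" for j
  proof -
    have "1 ^ Suc n \<sqsubset> c ^ Suc n" by (intro lt_power \<open>1 \<sqsubset> c\<close>) auto
    hence "c \<sqsubset> c ^ degree F"
      using lt_mult_cancel[OF nz, of 1 "c ^ Suc n"] by (simp add: n mult.commute)
    moreover have "coeff (?P \<circ>\<^sub>p [:0, c:]) (degree F) = c ^ degree F"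
      using P by (simp only: coeff_pcompose_linear) simp
    ultimately show ?thesis using nz by (auto simp: coeff_pCons split: nat.splits)
  qed
  with dom have "dominant (?P \<circ>\<^sub>p [:0, c:] + [:0, c:]) (degree F)"
    by (rule dominant_add)
  also have "?P \<circ>\<^sub>p [:0, c:] + [:0, c:] = F \<circ>\<^sub>p [:0, c:]"
    by (simp add: pcompose_diff pcompose_pCons)
  finally have "nroots (pderiv F) 0 c = degree F - 1"
    using nz by (intro dominant_nroots_pderiv) (simp_all add: n)
  moreover have "degree (pderiv F) = degree F - 1" by (rule degree_pderiv)
  moreover have "pderiv F \<noteq> 0" using assms(2) by (simp add: pderiv_eq_0_iff)
  hence c_in: "c \<in># proots (pderiv F)" using c by simp
  hence "filter_mset (\<lambda>r. r - 0 \<sqsubset> c) (proots (pderiv F)) \<noteq> proots (pderiv F)"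
    by (metis (no_types, lifting) diff_zero lt_irrefl mem_Collect_eq set_mset_filter)
  hence "size (filter_mset (\<lambda>r. r - 0 \<sqsubset> c) (proots (pderiv F))) < size (proots (pderiv F))"
    by (intro mset_subset_size) (auto simp: subset_mset_def)
  ultimately show False
    using size_proots_le[of "pderiv F"] by (simp add: nroots_def)
qed

end

section \<open>The ultrapower and its growth valuation\<close>

text \<open>Zorn's lemma for proper filters, whose chains have proper infima. A minimal proper
  filter decides every \<open>P\<close>, since adjoining a compatible \<open>P\<close> cannot refine
  it.\<close>

lemma ultrafilter_exists:
  fixes F :: "'a filter"
  assumes "F \<noteq> bot"
  shows "\<exists>U \<le> F. U \<noteq> bot \<and> (\<forall>P. eventually P U \<or> eventually (\<lambda>x. \<not> P x) U)"
proof -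
  let ?A = "{U. U \<le> F \<and> U \<noteq> bot}" and ?P = "\<lambda>U V :: 'a filter. V \<le> U"
  have "\<exists>m\<in>?A. \<forall>a\<in>?A. ?P m a \<longrightarrow> a = m"
  proof (rule predicate_Zorn)
    show "partial_order_on ?A (relation_of ?P ?A)"
      by (rule partial_order_on_relation_ofI) auto
    fix C assume C: "C \<in> Chains (relation_of ?P ?A)"
    hence sub: "C \<subseteq> ?A" and lin: "\<And>U V. U \<in> C \<Longrightarrow> V \<in> C \<Longrightarrow> U \<le> V \<or> V \<le> U"
      by (auto simp: Chains_def relation_of_def)
    show "\<exists>u\<in>?A. \<forall>a\<in>C. ?P a u"
    proof (cases "C = {}")
      case False
      have "eventually P (Inf C) \<longleftrightarrow> (\<exists>b\<in>C. eventually P b)" for P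
      proof (rule eventually_Inf_base[OF False])
        fix U V assume "U \<in> C" "V \<in> C"
        thus "\<exists>W\<in>C. W \<le> inf U V"
          using lin[of U V] by (auto simp: inf_absorb1 inf_absorb2)
      qed
      hence "Inf C \<noteq> bot"
        using sub unfolding eventually_False[symmetric] by blast
      moreover obtain U where "U \<in> C" using False by blast
      hence "Inf C \<le> F" using sub by (intro Inf_lower2[of U]) auto
      ultimately show ?thesis by (intro bexI[of _ "Inf C"]) (auto intro: Inf_lower)
    qed (use assms in auto)
  qed
  then obtain U where U: "U \<le> F" "U \<noteq> bot" "\<And>V. V \<le> U \<Longrightarrow> V \<noteq> bot \<Longrightarrow> V = U"
    using order_trans by blast
  have "eventually P U \<or> eventually (\<lambda>x. \<not> P x) U" for P
  proof (cases "inf U (principal {x. P x}) = bot")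
    case True
    hence "eventually (\<lambda>x. False) (inf U (principal {x. P x}))" by simp
    thus ?thesis by (simp add: eventually_inf_principal)
  next
    case False
    hence "inf U (principal {x. P x}) = U" by (intro U) auto
    hence "U \<le> principal {x. P x}" by (simp add: inf.absorb_iff1)
    thus ?thesis by (simp add: le_principal)
  qed
  thus ?thesis using U by blast
qed

text \<open>Chosen once and for all, as the type of ultrapowers cannot depend on the sequence at
  hand. Lying below \<open>sequentially\<close>, it inherits asymptotic statements.\<close>

definition nat_ultrafilter :: "nat filter" where
  "nat_ultrafilter = (SOME U. U \<le> sequentially \<and> U \<noteq> bot \<and>
     (\<forall>P. eventually P U \<or> eventually (\<lambda>n. \<not> P n) U))"

lemma nat_ultrafilter:
  "nat_ultrafilter \<le> sequentially" "nat_ultrafilter \<noteq> bot"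
  "eventually P nat_ultrafilter \<or> eventually (\<lambda>n. \<not> P n) nat_ultrafilter"
proof -
  have "\<exists>U. U \<le> sequentially \<and> U \<noteq> bot \<and> (\<forall>P. eventually P U \<or> eventually (\<lambda>n. \<not> P n) U)"
    using ultrafilter_exists[of sequentially] by auto
  from someI_ex[OF this]
  show "nat_ultrafilter \<le> sequentially" "nat_ultrafilter \<noteq> bot"
    "eventually P nat_ultrafilter \<or> eventually (\<lambda>n. \<not> P n) nat_ultrafilter"
    unfolding nat_ultrafilter_def by blast+
qed

lemma not_eventually_ultra:
  "\<not> eventually P nat_ultrafilter \<longleftrightarrow> eventually (\<lambda>n. \<not> P n) nat_ultrafilter"
proof
  assume "eventually (\<lambda>n. \<not> P n) nat_ultrafilter"
  show "\<not> eventually P nat_ultrafilter"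
  proof
    assume "eventually P nat_ultrafilter"
    with \<open>eventually (\<lambda>n. \<not> P n) nat_ultrafilter\<close> have "eventually (\<lambda>n. False) nat_ultrafilter"
      by eventually_elim auto
    thus False using nat_ultrafilter(2) by simp
  qed
qed (use nat_ultrafilter(3) in blast)

lemma eventually_ultra_sequentially:
  "eventually P sequentially \<Longrightarrow> eventually P nat_ultrafilter"
  using nat_ultrafilter(1) by (rule filter_leD)

\<comment> \<open>Ultrapowers of fields and ultraproducts of polynomials\<close>
quotient_type 'a ultrapower = "nat \<Rightarrow> 'a" / "\<lambda>x y. eventually (\<lambda>n. x n = y n) nat_ultrafilter"
proof (rule equivpI)
  show "reflp (\<lambda>x y. \<forall>\<^sub>F n in nat_ultrafilter. x n = y n)" by (auto simp: reflp_def)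
  show "symp (\<lambda>x y. \<forall>\<^sub>F n in nat_ultrafilter. x n = y n)" by (auto simp: symp_def eq_commute)
  show "transp (\<lambda>x y. \<forall>\<^sub>F n in nat_ultrafilter. x n = y n)"
    by (rule transpI) (auto elim: eventually_elim2)
qed

instantiation ultrapower :: (field) field
begin

lift_definition zero_ultrapower :: "'a ultrapower" is "\<lambda>_. 0" .
lift_definition one_ultrapower :: "'a ultrapower" is "\<lambda>_. 1" .
lift_definition plus_ultrapower :: "'a ultrapower \<Rightarrow> 'a ultrapower \<Rightarrow> 'a ultrapower"
  is "\<lambda>x y n. x n + y n" by (erule (1) eventually_elim2) simp
lift_definition minus_ultrapower :: "'a ultrapower \<Rightarrow> 'a ultrapower \<Rightarrow> 'a ultrapower"
  is "\<lambda>x y n. x n - y n" by (erule (1) eventually_elim2) simp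
lift_definition uminus_ultrapower :: "'a ultrapower \<Rightarrow> 'a ultrapower"
  is "\<lambda>x n. - x n" by (erule eventually_mono) simp
lift_definition times_ultrapower :: "'a ultrapower \<Rightarrow> 'a ultrapower \<Rightarrow> 'a ultrapower"
  is "\<lambda>x y n. x n * y n" by (erule (1) eventually_elim2) simp
lift_definition inverse_ultrapower :: "'a ultrapower \<Rightarrow> 'a ultrapower"
  is "\<lambda>x n. inverse (x n)" by (erule eventually_mono) simp
lift_definition divide_ultrapower :: "'a ultrapower \<Rightarrow> 'a ultrapower \<Rightarrow> 'a ultrapower"
  is "\<lambda>x y n. x n / y n" by (erule (1) eventually_elim2) simp

instance
proof
  fix a b c :: "'a ultrapower"
  show "a + b + c = a + (b + c)" by transfer (simp add: algebra_simps)
  show "a + b = b + a" by transfer (simp add: algebra_simps)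
  show "0 + a = a" by transfer simp
  show "- a + a = 0" by transfer simp
  show "a - b = a + - b" by transfer simp
  show "a * b * c = a * (b * c)" by transfer (simp add: algebra_simps)
  show "a * b = b * a" by transfer (simp add: algebra_simps)
  show "1 * a = a" by transfer simp
  show "(a + b) * c = a * c + b * c" by transfer (simp add: algebra_simps)
  show "(0 :: 'a ultrapower) \<noteq> 1" by transfer (simp add: nat_ultrafilter)
  show "a div b = a * inverse b" by transfer (simp add: divide_inverse)
  show "inverse (0 :: 'a ultrapower) = 0" by transfer simp
  show "inverse a * a = 1" if "a \<noteq> 0"
    using that by transfer (auto simp: not_eventually_ultra elim!: eventually_mono)
qed

end

lemma of_nat_ultrapower: "of_nat k = abs_ultrapower (\<lambda>_. of_nat k)"
  by (induction k) (simp_all add: zero_ultrapower_def one_ultrapower_def plus_ultrapower.abs_eq)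

lemma power_ultrapower: "abs_ultrapower x ^ k = abs_ultrapower (\<lambda>n. x n ^ k)"
  by (induction k) (simp_all add: one_ultrapower_def times_ultrapower.abs_eq)

lemma sum_ultrapower:
  "(\<Sum>i\<in>I. abs_ultrapower (x i)) = abs_ultrapower (\<lambda>n. \<Sum>i\<in>I. x i n)"
  by (induction I rule: infinite_finite_induct)
     (simp_all add: zero_ultrapower_def plus_ultrapower.abs_eq)

lemma ultrapower_cases: obtains x where "a = abs_ultrapower x"
proof -
  have "\<exists>x. a = abs_ultrapower x"
    by (induction a rule: ultrapower.abs_induct) blast
  thus ?thesis using that by blast
qed

lemma abs_ultrapower_eq_0_iff:
  "abs_ultrapower x = 0 \<longleftrightarrow> eventually (\<lambda>n. x n = 0) nat_ultrafilter"
  by (simp add: zero_ultrapower_def ultrapower.abs_eq_iff)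

instance ultrapower :: (field_char_0) field_char_0
proof
  show "inj (of_nat :: nat \<Rightarrow> 'a ultrapower)"
    by (rule injI) (simp add: of_nat_ultrapower ultrapower.abs_eq_iff nat_ultrafilter)
qed

instance ultrapower :: (alg_closed_field) alg_closed_field
proof intro_classes
  fix n :: nat and f :: "nat \<Rightarrow> 'a ultrapower"
  assume n: "n > 0" "f n \<noteq> 0"
  have "\<forall>k. \<exists>g. f k = abs_ultrapower g" using ultrapower_cases by metis
  then obtain g where g: "\<And>k. f k = abs_ultrapower (g k)" by metis
  have "\<exists>x. g n i \<noteq> 0 \<longrightarrow> (\<Sum>k\<le>n. g k i * x ^ k) = 0" for i
    using alg_closed[of n "\<lambda>k. g k i"] n(1) by auto
  then obtain x where x: "\<And>i. g n i \<noteq> 0 \<Longrightarrow> (\<Sum>k\<le>n. g k i * x i ^ k) = 0" by metis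
  have "eventually (\<lambda>i. g n i \<noteq> 0) nat_ultrafilter"
    using n(2) by (simp add: g abs_ultrapower_eq_0_iff not_eventually_ultra)
  hence "eventually (\<lambda>i. (\<Sum>k\<le>n. g k i * x i ^ k) = 0) nat_ultrafilter"
    by eventually_elim (rule x)
  hence "(\<Sum>k\<le>n. f k * abs_ultrapower x ^ k) = 0"
    by (simp add: g power_ultrapower times_ultrapower.abs_eq sum_ultrapower abs_ultrapower_eq_0_iff)
  thus "\<exists>x. (\<Sum>k\<le>n. f k * x ^ k) = 0" by blast
qed

definition ultra_poly :: "nat \<Rightarrow> (nat \<Rightarrow> 'a :: field poly) \<Rightarrow> 'a ultrapower poly" where
  "ultra_poly d F = (\<Sum>i\<le>d. monom (abs_ultrapower (\<lambda>n. coeff (F n) i)) i)"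

lemma coeff_ultra_poly:
  assumes "\<And>n. degree (F n) \<le> d"
  shows "coeff (ultra_poly d F) i = abs_ultrapower (\<lambda>n. coeff (F n) i)"
proof (cases "i \<le> d")
  case True
  thus ?thesis by (simp add: ultra_poly_def coeff_sum coeff_monom sum.delta)
next
  case False
  hence "coeff (F n) i = 0" for n
    using assms[of n] by (intro coeff_eq_0) simp
  thus ?thesis using False
    by (simp add: ultra_poly_def coeff_sum coeff_monom zero_ultrapower_def)
qed

lemma poly_ultra_poly:
  assumes "\<And>n. degree (F n) \<le> d"
  shows "poly (ultra_poly d F) (abs_ultrapower x) = abs_ultrapower (\<lambda>n. poly (F n) (x n))"
proof -
  have "poly (F n) y = (\<Sum>i\<le>d. coeff (F n) i * y ^ i)" for n y
    using assms[of n] unfolding poly_altdef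
    by (intro sum.mono_neutral_left) (auto simp: coeff_eq_0)
  thus ?thesis
    by (simp add: ultra_poly_def poly_sum poly_monom power_ultrapower times_ultrapower.abs_eq
      sum_ultrapower)
qed

lemma pderiv_ultra_poly:
  fixes F :: "nat \<Rightarrow> 'a :: field_char_0 poly"
  assumes "\<And>n. degree (F n) \<le> d"
  shows "pderiv (ultra_poly d F) = ultra_poly d (\<lambda>n. pderiv (F n))"
proof (rule poly_eqI)
  fix i
  have "degree (pderiv (F n)) \<le> d" for n
    using assms[of n] by (simp add: degree_pderiv)
  thus "coeff (pderiv (ultra_poly d F)) i = coeff (ultra_poly d (\<lambda>n. pderiv (F n))) i"
    using assms
    by (simp add: coeff_pderiv coeff_ultra_poly of_nat_ultrapower times_ultrapower.abs_eq
       del: of_nat_Suc)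
qed

text \<open>
  The factor \<^term>\<open>exp (\<epsilon> * M n)\<close> absorbs the constant 2 in \<open>|x + y| \<le> 2 max |x| |y|\<close> as well as
  the absolute values of integers, when \<^term>\<open>M\<close> tends to infinity.
\<close>

lift_definition growth_le :: "('a :: field \<Rightarrow> real) \<Rightarrow> (nat \<Rightarrow> real) \<Rightarrow> 'a ultrapower \<Rightarrow> 'a ultrapower \<Rightarrow> bool"
  is "\<lambda>v M x y. \<forall>\<epsilon>>0. eventually (\<lambda>n. v (x n) \<le> exp (\<epsilon> * M n) * v (y n)) nat_ultrafilter"
proof -
  fix v :: "'a \<Rightarrow> real" and M :: "nat \<Rightarrow> real" and x x' y y' :: "nat \<Rightarrow> 'a"
  assume *: "\<forall>\<^sub>F n in nat_ultrafilter. x n = x' n" "\<forall>\<^sub>F n in nat_ultrafilter. y n = y' n"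
  have "(\<forall>\<^sub>F n in nat_ultrafilter. v (x n) \<le> exp (\<epsilon> * M n) * v (y n)) \<longleftrightarrow>
        (\<forall>\<^sub>F n in nat_ultrafilter. v (x' n) \<le> exp (\<epsilon> * M n) * v (y' n))" for \<epsilon>
    using * by (intro eventually_subst) (auto elim: eventually_elim2)
  thus "(\<forall>\<epsilon>>0. \<forall>\<^sub>F n in nat_ultrafilter. v (x n) \<le> exp (\<epsilon> * M n) * v (y n)) =
        (\<forall>\<epsilon>>0. \<forall>\<^sub>F n in nat_ultrafilter. v (x' n) \<le> exp (\<epsilon> * M n) * v (y' n))" by simp
qed

lemma growth_le_valuation_preorder:
  fixes v :: "'a :: {alg_closed_field, field_char_0} \<Rightarrow> real"
  assumes v: "absolute_value v" and M: "filterlim M at_top sequentially"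
  shows "valuation_preorder (growth_le v M)"
proof
  have v_nonneg: "v x \<ge> 0" and v_0: "v x = 0 \<longleftrightarrow> x = 0" and v_mult: "v (x * y) = v x * v y"
    and v_add: "v (x + y) \<le> v x + v y" for x y
    using v by (auto simp: absolute_value_def)
  have M_ge: "eventually (\<lambda>n. M n \<ge> C) nat_ultrafilter" for C
    using M by (intro eventually_ultra_sequentially) (auto simp: filterlim_at_top)
  have le_iff: "growth_le v M (abs_ultrapower x) (abs_ultrapower y) \<longleftrightarrow>
      (\<forall>\<epsilon>>0. \<forall>\<^sub>F n in nat_ultrafilter. v (x n) \<le> exp (\<epsilon> * M n) * v (y n))" for x y
    by (rule growth_le.abs_eq)
  fix x y z w :: "'a ultrapower" and k :: nat
  obtain X Y Z W where reps: "x = abs_ultrapower X" "y = abs_ultrapower Y"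
      "z = abs_ultrapower Z" "w = abs_ultrapower W"
    using ultrapower_cases by metis
  \<comment> \<open>If \<open>x\<close> exceeds \<open>y\<close> by some factor
    \<open>exp (\<epsilon> * M n)\<close> for almost all \<open>n\<close>, then \<open>y\<close> is
    bounded by \<open>x\<close> outright.\<close>
  show "growth_le v M x y \<or> growth_le v M y x"
  proof (cases "growth_le v M x y")
    case False
    then obtain \<epsilon> where \<epsilon>: "\<epsilon> > 0" "\<forall>\<^sub>F n in nat_ultrafilter. \<not> v (X n) \<le> exp (\<epsilon> * M n) * v (Y n)"
      by (auto simp: reps le_iff not_eventually_ultra)
    have "\<forall>\<^sub>F n in nat_ultrafilter. v (Y n) \<le> exp (\<delta> * M n) * v (X n)" if "\<delta> > 0" for \<delta>
      using \<epsilon>(2) M_ge[of 0]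
    proof eventually_elim
      case (elim n)
      have "1 * v (Y n) \<le> exp (\<epsilon> * M n) * v (Y n)"
        using elim(2) \<epsilon>(1) v_nonneg by (intro mult_right_mono) auto
      also have "\<dots> \<le> 1 * v (X n)" using elim(1) by simp
      also have "\<dots> \<le> exp (\<delta> * M n) * v (X n)"
        using elim(2) that v_nonneg by (intro mult_right_mono) auto
      finally show ?case by simp
    qed
    thus ?thesis by (simp add: reps le_iff)
  qed simp
  show "growth_le v M x z" if "growth_le v M x y" "growth_le v M y z"
    unfolding reps le_iff
  proof (intro allI impI)
    fix \<epsilon> :: real assume \<epsilon>: "\<epsilon> > 0"
    have "\<forall>\<^sub>F n in nat_ultrafilter. v (X n) \<le> exp (\<epsilon> / 2 * M n) * v (Y n)"
        "\<forall>\<^sub>F n in nat_ultrafilter. v (Y n) \<le> exp (\<epsilon> / 2 * M n) * v (Z n)"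
      using that half_gt_zero[OF \<epsilon>] unfolding reps le_iff by blast+
    thus "\<forall>\<^sub>F n in nat_ultrafilter. v (X n) \<le> exp (\<epsilon> * M n) * v (Z n)"
    proof eventually_elim
      case (elim n)
      have "v (X n) \<le> exp (\<epsilon> / 2 * M n) * (exp (\<epsilon> / 2 * M n) * v (Z n))"
        by (rule order_trans[OF elim(1) mult_left_mono[OF elim(2)]]) simp
      also have "\<dots> = exp (\<epsilon> * M n) * v (Z n)"
        by (simp add: mult.assoc[symmetric] exp_add[symmetric])
      finally show ?case .
    qed
  qed
  show "growth_le v M (x + y) z" if "growth_le v M x z" "growth_le v M y z"
    unfolding reps le_iff plus_ultrapower.abs_eq
  proof (intro allI impI)
    fix \<epsilon> :: real assume \<epsilon>: "\<epsilon> > 0"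
    have *: "\<forall>\<^sub>F n in nat_ultrafilter. v (X n) \<le> exp (\<epsilon> / 2 * M n) * v (Z n)"
        "\<forall>\<^sub>F n in nat_ultrafilter. v (Y n) \<le> exp (\<epsilon> / 2 * M n) * v (Z n)"
      using that half_gt_zero[OF \<epsilon>] unfolding reps le_iff by blast+
    \<comment> \<open>The threshold makes \<open>exp (\<epsilon> / 2 * M n)\<close> at least 2; the
      other half of \<open>\<epsilon>\<close> pays for the two hypotheses.\<close>
    from * M_ge[of "2 * ln 2 / \<epsilon>"]
    show "\<forall>\<^sub>F n in nat_ultrafilter. v (X n + Y n) \<le> exp (\<epsilon> * M n) * v (Z n)"
    proof eventually_elim
      case (elim n)
      have "ln 2 \<le> \<epsilon> / 2 * M n" using elim(3) \<open>\<epsilon> > 0\<close> by (simp add: field_simps)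
      hence "exp (ln 2) \<le> exp (\<epsilon> / 2 * M n)" by (simp only: exp_le_cancel_iff)
      hence 2: "2 \<le> exp (\<epsilon> / 2 * M n)" by simp
      have "v (X n + Y n) \<le> 2 * (exp (\<epsilon> / 2 * M n) * v (Z n))"
        using v_add[of "X n" "Y n"] elim by linarith
      also have "\<dots> \<le> exp (\<epsilon> / 2 * M n) * (exp (\<epsilon> / 2 * M n) * v (Z n))"
        using 2 v_nonneg by (intro mult_right_mono) auto
      also have "\<dots> = exp (\<epsilon> * M n) * v (Z n)"
        by (simp add: mult.assoc[symmetric] exp_add[symmetric])
      finally show ?case .
    qed
  qed
  show "growth_le v M (x * w) (y * w)" if "growth_le v M x y"
    unfolding reps le_iff times_ultrapower.abs_eq
  proof (intro allI impI)
    fix \<epsilon> :: real assume "\<epsilon> > 0"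
    hence "\<forall>\<^sub>F n in nat_ultrafilter. v (X n) \<le> exp (\<epsilon> * M n) * v (Y n)"
      using that unfolding reps le_iff by blast
    thus "\<forall>\<^sub>F n in nat_ultrafilter. v (X n * W n) \<le> exp (\<epsilon> * M n) * v (Y n * W n)"
      by eventually_elim (simp add: v_mult mult.assoc[symmetric] mult_right_mono v_nonneg)
  qed
  show "x = 0" if "growth_le v M x 0"
  proof -
    have "\<forall>\<^sub>F n in nat_ultrafilter. v (X n) \<le> exp (1 * M n) * v 0"
      using that zero_less_one unfolding reps zero_ultrapower_def le_iff by blast
    hence "\<forall>\<^sub>F n in nat_ultrafilter. X n = 0"
      by eventually_elim (metis v_0 v_nonneg mult_zero_right order_antisym)
    thus ?thesis by (simp add: reps abs_ultrapower_eq_0_iff)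
  qed
  show "growth_le v M 1 (of_nat k)" if "k > 0"
    unfolding one_ultrapower_def of_nat_ultrapower le_iff
  proof (intro allI impI)
    fix \<epsilon> :: real assume "\<epsilon> > 0"
    have pos: "v (of_nat k) > 0" using that v_0 v_nonneg by (metis of_nat_0_eq_iff order_le_less not_gr0)
    show "\<forall>\<^sub>F n in nat_ultrafilter. v 1 \<le> exp (\<epsilon> * M n) * v (of_nat k)"
      using M_ge[of "(v 1 / v (of_nat k)) / \<epsilon>"]
    proof eventually_elim
      case (elim n)
      hence "\<epsilon> * (v 1 / v (of_nat k) / \<epsilon>) \<le> \<epsilon> * M n"
        using \<open>\<epsilon> > 0\<close> by (intro mult_left_mono) auto
      hence "v 1 / v (of_nat k) \<le> \<epsilon> * M n" using \<open>\<epsilon> > 0\<close> by simp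
      also have "\<dots> \<le> exp (\<epsilon> * M n)" using exp_ge_add_one_self[of "\<epsilon> * M n"] by linarith
      finally show ?case using pos by (simp add: field_simps)
    qed
  qed
qed

text \<open>Fixed points, 2-cycles and critical points of the ultraproduct \<open>P\<close> are
  represented by sequences of those of the \<open>F n\<close>. The hypotheses make its multipliers
  integral for \<open>growth_le v M\<close>, hence also its fixed and critical points.\<close>

lemma growth_of_fixed_and_critical_points:
  fixes v :: "'a :: {alg_closed_field, field_char_0} \<Rightarrow> real" and F :: "nat \<Rightarrow> 'a poly"
  assumes v: "absolute_value v" and M: "filterlim M at_top sequentially"
    and F: "\<And>n. lead_coeff (F n) = 1" "\<And>n. degree (F n) = d" "\<And>n. poly (F n) 0 = 0" and d: "d \<ge> 2"
    and fixed: "\<And>\<epsilon>. \<epsilon> > 0 \<Longrightarrow> \<forall>\<^sub>F n in sequentially. \<forall>x. poly (F n) x = x \<longrightarrow>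
                  v (poly (pderiv (F n)) x) \<le> exp (\<epsilon> * M n)"
    and cycle: "\<And>\<epsilon>. d \<ge> 4 \<Longrightarrow> \<epsilon> > 0 \<Longrightarrow> \<forall>\<^sub>F n in sequentially. \<forall>x.
                  poly (F n) (poly (F n) x) = x \<longrightarrow> poly (F n) x \<noteq> x \<longrightarrow>
                  v (poly (pderiv (F n)) x * poly (pderiv (F n)) (poly (F n) x)) \<le> exp (\<epsilon> * M n)"
    and p: "\<And>n. poly (F n) (p n) = p n \<or> poly (pderiv (F n)) (p n) = 0"
    and \<epsilon>: "\<epsilon> > 0"
  shows "\<forall>\<^sub>F n in nat_ultrafilter. v (p n) \<le> exp (\<epsilon> * M n)"
proof -
  interpret valuation_preorder "growth_le v M"
    by (rule growth_le_valuation_preorder[OF v M])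
  have v1: "v 1 = 1"
  proof -
    have "v (1 * 1) = v 1 * v 1" "v 1 \<noteq> 0" using v unfolding absolute_value_def by (blast, simp)
    thus ?thesis by simp
  qed
  have le_one: "growth_le v M (abs_ultrapower X) 1 \<longleftrightarrow>
      (\<forall>\<epsilon>>0. \<forall>\<^sub>F n in nat_ultrafilter. v (X n) \<le> exp (\<epsilon> * M n))" for X
    by (simp add: one_ultrapower_def growth_le.abs_eq v1)
  define P where "P = ultra_poly d F"
  have poly_P: "poly P (abs_ultrapower X) = abs_ultrapower (\<lambda>n. poly (F n) (X n))" for X
    unfolding P_def by (rule poly_ultra_poly) (simp add: F)
  have deriv_P: "poly (pderiv P) (abs_ultrapower X) = abs_ultrapower (\<lambda>n. poly (pderiv (F n)) (X n))" for X
    unfolding P_def using F(2) d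
    by (subst pderiv_ultra_poly, simp, intro poly_ultra_poly) (simp add: degree_pderiv)
  have coeff_P: "coeff P i = abs_ultrapower (\<lambda>n. coeff (F n) i)" for i
    unfolding P_def by (rule coeff_ultra_poly) (simp add: F)
  have Pd: "coeff P d = 1" using F(1,2) by (simp add: coeff_P one_ultrapower_def)
  have deg_P: "degree P = d"
  proof (rule antisym)
    show "degree P \<le> d"
      by (rule degree_le) (use F(2) in \<open>auto simp: coeff_P coeff_eq_0 zero_ultrapower_def\<close>)
    show "d \<le> degree P" by (rule le_degree) (simp add: Pd)
  qed
  have P0: "poly P 0 = 0"
    by (simp add: zero_ultrapower_def poly_P F)
  have fixed_P: "growth_le v M (poly (pderiv P) x) 1" if "poly P x = x" for x
  proof -
    obtain X where X: "x = abs_ultrapower X" by (rule ultrapower_cases)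
    have ev: "\<forall>\<^sub>F n in nat_ultrafilter. poly (F n) (X n) = X n"
      using that by (simp add: X poly_P ultrapower.abs_eq_iff)
    show ?thesis unfolding X deriv_P le_one
    proof (intro allI impI)
      fix \<epsilon> :: real assume "\<epsilon> > 0"
      from ev eventually_ultra_sequentially[OF fixed[OF this]]
      show "\<forall>\<^sub>F n in nat_ultrafilter. v (poly (pderiv (F n)) (X n)) \<le> exp (\<epsilon> * M n)"
        by eventually_elim blast
    qed
  qed
  have cycle_P: "growth_le v M (poly (pderiv P) x * poly (pderiv P) (poly P x)) 1"
    if "d \<ge> 4" "poly P (poly P x) = x" "poly P x \<noteq> x" for x
  proof -
    obtain X where X: "x = abs_ultrapower X" by (rule ultrapower_cases)
    have ev: "\<forall>\<^sub>F n in nat_ultrafilter. poly (F n) (poly (F n) (X n)) = X n"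
        "\<forall>\<^sub>F n in nat_ultrafilter. poly (F n) (X n) \<noteq> X n"
      using that by (simp_all add: X poly_P ultrapower.abs_eq_iff not_eventually_ultra)
    show ?thesis unfolding X deriv_P poly_P times_ultrapower.abs_eq le_one
    proof (intro allI impI)
      fix \<epsilon> :: real assume "\<epsilon> > 0"
      from ev eventually_ultra_sequentially[OF cycle[OF that(1) this]]
      show "\<forall>\<^sub>F n in nat_ultrafilter.
        v (poly (pderiv (F n)) (X n) * poly (pderiv (F n)) (poly (F n) (X n))) \<le> exp (\<epsilon> * M n)"
        by eventually_elim blast
    qed
  qed
  have fixed_le: "growth_le v M x 1" if "poly P x = x" for x
    using fixed_points_le_one[of P, OF _ _ P0 fixed_P _ that] Pd deg_P d cycle_P by simp
  have crit_le: "growth_le v M x 1" if "poly (pderiv P) x = 0" for x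
    using critical_points_le_one[of P, OF _ _ fixed_le that] Pd deg_P d by simp
  \<comment> \<open>The ultrafilter decides whether \<open>p n\<close> is a fixed point for almost
    all \<open>n\<close> or a critical point for almost all \<open>n\<close>.\<close>
  have "growth_le v M (abs_ultrapower p) 1"
  proof (cases "\<forall>\<^sub>F n in nat_ultrafilter. poly (F n) (p n) = p n")
    case True
    thus ?thesis by (intro fixed_le) (simp add: poly_P ultrapower.abs_eq_iff)
  next
    case False
    hence "\<forall>\<^sub>F n in nat_ultrafilter. poly (F n) (p n) \<noteq> p n"
      by (simp add: not_eventually_ultra)
    hence "\<forall>\<^sub>F n in nat_ultrafilter. poly (pderiv (F n)) (p n) = 0"
      by eventually_elim (use p in blast)
    thus ?thesis by (intro crit_le) (simp add: deriv_P abs_ultrapower_eq_0_iff)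
  qed
  thus ?thesis using \<epsilon> unfolding le_one by blast
qed

section \<open>Multiplier spectra for periods 1 and 2\<close>

lemma iterate_poly_1: "iterate_poly f 1 = f"
  by (simp add: iterate_poly_def)

lemma iterate_poly_2: "iterate_poly f 2 = f \<circ>\<^sub>p f"
  by (simp add: iterate_poly_def numeral_2_eq_2)

lemma poly_pderiv_pcompose: "poly (pderiv (p \<circ>\<^sub>p q)) z = poly (pderiv p) (poly q z) * poly (pderiv q) z"
  by (simp add: pderiv_pcompose poly_pcompose)

text \<open>Taylor's formula p(X + q) - p = q h, in which h is congruent to p' modulo q.\<close>

lemma pcompose_add_diff:
  fixes p q :: "'a :: idom poly"
  obtains h where "p \<circ>\<^sub>p ([:0, 1:] + q) - p = q * h"
    "\<And>z. poly q z = 0 \<Longrightarrow> poly h z = poly (pderiv p) z"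
proof -
  have "\<exists>h. p \<circ>\<^sub>p ([:0, 1:] + q) - p = q * h \<and> (\<forall>z. poly q z = 0 \<longrightarrow> poly h z = poly (pderiv p) z)"
  proof (induction p)
    case 0
    show ?case by (intro exI[of _ 0]) simp
  next
    case (pCons a p)
    then obtain h where h: "p \<circ>\<^sub>p ([:0, 1:] + q) - p = q * h"
      "\<And>z. poly q z = 0 \<Longrightarrow> poly h z = poly (pderiv p) z" by blast
    let ?X = "[:0, 1:] :: 'a poly"
    have "pCons a p = [:a:] + ?X * p" by simp
    moreover have "pCons a p \<circ>\<^sub>p (?X + q) = [:a:] + (?X + q) * (p \<circ>\<^sub>p (?X + q))"
      by (rule pcompose_pCons)
    ultimately have "pCons a p \<circ>\<^sub>p (?X + q) - pCons a p =
        ?X * (p \<circ>\<^sub>p (?X + q) - p) + q * (p \<circ>\<^sub>p (?X + q))"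
      by (simp only: algebra_simps)
    also have "\<dots> = q * (?X * h + p \<circ>\<^sub>p (?X + q))"
      unfolding h(1) by (simp only: distrib_left mult.left_commute)
    finally have "pCons a p \<circ>\<^sub>p (?X + q) - pCons a p = q * (?X * h + p \<circ>\<^sub>p (?X + q))" .
    moreover have "poly (?X * h + p \<circ>\<^sub>p (?X + q)) z = poly (pderiv (pCons a p)) z" if "poly q z = 0" for z
      using that h(2)[OF that] by (simp add: poly_pcompose pderiv_pCons)
    ultimately show ?case by blast
  qed
  thus ?thesis using that by blast
qed

lemma order_eq_1:
  fixes p :: "'a :: field_char_0 poly"
  assumes "poly p z = 0" "poly (pderiv p) z \<noteq> 0"
  shows "order z p = 1"
proof -
  have "p \<noteq> 0" using assms(2) by auto
  hence "order z p = Suc (order z (pderiv p))" using assms(1) by (rule order_pderiv)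
  thus ?thesis using assms(2) by (simp add: order_0I)
qed

lemma pcompose_power_left: "(p ^ n) \<circ>\<^sub>p q = (p \<circ>\<^sub>p q) ^ n"
  for p q :: "'a :: comm_semiring_1 poly"
  by (induction n) (simp_all add: pcompose_1 pcompose_mult)

lemma order_power_eq: "p \<noteq> 0 \<Longrightarrow> order a (p ^ n) = n * order a p"
  for p :: "'a :: idom poly"
  by (induction n) (simp_all add: order_mult)

lemma order_pcompose:
  fixes p f :: "'a :: field_char_0 poly"
  assumes "p \<noteq> 0" "poly (pderiv f) z \<noteq> 0"
  shows "order z (p \<circ>\<^sub>p f) = order (poly f z) p"
proof -
  let ?w = "poly f z"
  obtain s where s: "p = [:- ?w, 1:] ^ order ?w p * s" "\<not> [:- ?w, 1:] dvd s"
    using order_decomp[OF assms(1)] by blast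
  have sw: "poly s ?w \<noteq> 0" using s(2) by (simp add: poly_eq_0_iff_dvd)
  have fw: "[:- ?w, 1:] \<circ>\<^sub>p f = f - [:?w:]" by (simp add: pcompose_pCons)
  have comp: "p \<circ>\<^sub>p f = (f - [:?w:]) ^ order ?w p * (s \<circ>\<^sub>p f)"
    by (subst s(1)) (simp only: pcompose_mult pcompose_power_left fw)
  have ord: "order z (f - [:?w:]) = 1"
    using assms(2) by (intro order_eq_1) (simp_all add: pderiv_diff pderiv_pCons)
  have nz: "f - [:?w:] \<noteq> 0"
  proof
    assume "f - [:?w:] = 0"
    hence "pderiv f = pderiv [:?w:]" by simp
    thus False using assms(2) by (simp add: pderiv_pCons)
  qed
  have "poly (s \<circ>\<^sub>p f) z \<noteq> 0" using sw by (simp add: poly_pcompose)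
  hence "s \<circ>\<^sub>p f \<noteq> 0" "order z (s \<circ>\<^sub>p f) = 0" by (auto simp: order_0I)
  thus ?thesis unfolding comp using nz ord
    by (subst order_mult) (simp_all add: order_power_eq)
qed

text \<open>Two exchanged points contribute equal factors, and a point fixed by
  \<open>\<sigma>\<close> has even exponent, so the square root is assembled orbit by orbit. With
  \<open>poly f\<close> as \<open>\<sigma>\<close> this yields the multiplier polynomial of period
  2.\<close>

lemma involution_prod_square:
  fixes h :: "'b \<Rightarrow> 'a :: idom poly"
  assumes "finite Z"
    and "\<And>z. z \<in> Z \<Longrightarrow> \<sigma> z \<in> Z" "\<And>z. z \<in> Z \<Longrightarrow> \<sigma> (\<sigma> z) = z"
    and "\<And>z. z \<in> Z \<Longrightarrow> h (\<sigma> z) = h z" "\<And>z. z \<in> Z \<Longrightarrow> n (\<sigma> z) = n z"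
    and "\<And>z. z \<in> Z \<Longrightarrow> \<sigma> z = z \<Longrightarrow> even (n z)"
    and "\<And>z. z \<in> Z \<Longrightarrow> lead_coeff (h z) = 1"
  shows "\<exists>p. lead_coeff p = 1 \<and> p ^ 2 = (\<Prod>z\<in>Z. h z ^ n z)"
  using assms
proof (induction "card Z" arbitrary: Z rule: less_induct)
  case less
  show ?case
  proof (cases "Z = {}")
    case True
    thus ?thesis by (intro exI[of _ 1]) simp
  next
    case False
    then obtain z where z: "z \<in> Z" by blast
    let ?Z = "Z - {z, \<sigma> z}"
    have "card ?Z < card Z" using less.prems(1) z by (intro psubset_card_mono) auto
    moreover have "\<sigma> y \<in> ?Z" if "y \<in> ?Z" for y
      using that less.prems(2,3) z by (metis DiffD1 DiffD2 DiffI insertCI insertE singletonD)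
    ultimately have "\<exists>p. lead_coeff p = 1 \<and> p ^ 2 = (\<Prod>z\<in>?Z. h z ^ n z)"
      using less.prems by (intro less.hyps) auto
    then obtain p where p: "lead_coeff p = 1" "p ^ 2 = (\<Prod>z\<in>?Z. h z ^ n z)" by blast
    have sz: "\<sigma> z \<in> Z" using z less.prems by blast
    have split: "(\<Prod>z\<in>Z. h z ^ n z) = (\<Prod>z\<in>?Z. h z ^ n z) * (\<Prod>z\<in>{z, \<sigma> z}. h z ^ n z)"
      using less.prems(1) z sz by (subst prod.subset_diff[of "{z, \<sigma> z}" Z]) auto
    have hz: "lead_coeff (h z) = 1" using less.prems z by blast
    show ?thesis
    proof (cases "\<sigma> z = z")
      case True
      then obtain k where "n z = 2 * k" using less.prems(6)[OF z] by (auto elim: evenE)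
      hence "(p * h z ^ k) ^ 2 = (\<Prod>z\<in>Z. h z ^ n z)"
        using True by (simp add: split p(2) power_mult_distrib power_mult[symmetric] mult.commute)
      thus ?thesis using p hz
        by (intro exI[of _ "p * h z ^ k"]) (simp add: lead_coeff_mult lead_coeff_power)
    next
      case False
      hence "(p * h z ^ n z) ^ 2 = (\<Prod>z\<in>Z. h z ^ n z)"
        using less.prems(4,5)[OF z]
        by (simp add: split p(2) power_mult_distrib power2_eq_square[of "h z ^ n z"])
      thus ?thesis using p hz
        by (intro exI[of _ "p * h z ^ n z"]) (simp add: lead_coeff_mult lead_coeff_power)
    qed
  qed
qed


section \<open>Dynatomic and multiplier polynomials of periods 1 and 2\<close>

locale iterated_polynomial =
  fixes f :: "'a :: {alg_closed_field, field_char_0} poly"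
  assumes degree_ge_2: "degree f \<ge> 2"
begin

lemma fixed_poly_nonzero: "f - [:0, 1:] \<noteq> 0"
  using iterate_poly_neq_X[OF degree_ge_2, of 1] by (simp only: iterate_poly_1) simp

lemma period_2_poly_nonzero: "f \<circ>\<^sub>p f - [:0, 1:] \<noteq> 0"
  using iterate_poly_neq_X[OF degree_ge_2, of 2] by (simp only: iterate_poly_2) simp

lemma dynatomic_1: "dynatomic f 1 = f - [:0, 1:]"
proof (rule dynatomic_eqI[OF degree_ge_2, where \<Phi> = "\<lambda>_. f - [:0, 1:]"])
  fix q :: nat assume "q dvd 1"
  hence "q = 1" by simp
  thus "iterate_poly f q - [:0, 1:] = (\<Prod>k | k dvd q. f - [:0, 1:])"
    by (simp only: iterate_poly_1) simp
qed simp

lemma multiplier_spectrum_1: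
  "multiplier_spectrum f 1 = image_mset (poly (pderiv f)) (proots (f - [:0, 1:]))"
proof -
  let ?P = "\<Prod>x\<in>#image_mset (poly (pderiv f)) (proots (f - [:0, 1:])). [:-x, 1:]"
  have "lead_coeff (\<Prod>x\<in>#A. [:-x, 1:]) = 1" for A :: "'a multiset"
    by (induction A) (simp_all add: lead_coeff_mult del: mult_pCons_left)
  hence lead: "lead_coeff ?P = 1" by blast
  have eq: "?P = (\<Prod>z\<in>#proots (f - [:0, 1:]). [:- poly (pderiv f) z, 1:])"
    by (simp add: image_mset.compositionality comp_def)
  have "multiplier_poly f 1 = ?P"
    unfolding multiplier_poly_def dynatomic_1 iterate_poly_1 eq[symmetric] power_one_right
    using lead by (intro the_equality) blast+
  thus ?thesis
    by (simp only: multiplier_spectrum_def proots_prod_linear)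
qed

definition period_2_factor :: "'a poly" where
  "period_2_factor = (f \<circ>\<^sub>p f - [:0, 1:]) div (f - [:0, 1:])"

text \<open>Taylor's formula with q = f - X reads f(f) - f = q h. Hence f(f) - X = q (1 + h), and h
  agrees with f' at the fixed points.\<close>

lemma period_2_factor:
  "f \<circ>\<^sub>p f - [:0, 1:] = (f - [:0, 1:]) * period_2_factor"
  "poly f z = z \<Longrightarrow> poly period_2_factor z = 1 + poly (pderiv f) z"
proof -
  let ?p = "f - [:0, 1:]"
  obtain h where h: "f \<circ>\<^sub>p ([:0, 1:] + ?p) - f = ?p * h"
    "\<And>z. poly ?p z = 0 \<Longrightarrow> poly h z = poly (pderiv f) z"
    using pcompose_add_diff[of f ?p] by blast
  have "f \<circ>\<^sub>p f - [:0, 1:] = ?p * h + ?p"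
    unfolding h(1)[symmetric] by simp
  hence "f \<circ>\<^sub>p f - [:0, 1:] = ?p * (1 + h)"
    by (simp only: distrib_left mult_1_right add.commute)
  hence "period_2_factor = 1 + h" "f \<circ>\<^sub>p f - [:0, 1:] = ?p * (1 + h)"
    using fixed_poly_nonzero by (simp_all add: period_2_factor_def)
  thus "f \<circ>\<^sub>p f - [:0, 1:] = ?p * period_2_factor"
    "poly f z = z \<Longrightarrow> poly period_2_factor z = 1 + poly (pderiv f) z"
    using h(2)[of z] by simp_all
qed

lemma period_2_factor_nonzero: "period_2_factor \<noteq> 0"
  using period_2_factor(1) period_2_poly_nonzero by auto

lemma dynatomic_2: "dynatomic f 2 = period_2_factor"
proof -
  have "dynatomic f 2 = (\<lambda>k :: nat. if k = 1 then f - [:0, 1:] else period_2_factor) 2"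
  proof (rule dynatomic_eqI[OF degree_ge_2, where \<Phi> = "\<lambda>k. if k = 1 then f - [:0, 1:] else period_2_factor"])
    fix q :: nat assume q: "q > 0" "q dvd 2"
    have "q \<le> 2" using q(2) by (rule dvd_imp_le) simp
    with q(1) consider "q = 1" | "q = 2" by linarith
    thus "iterate_poly f q - [:0, 1:] = (\<Prod>k | k dvd q. if k = 1 then f - [:0, 1:] else period_2_factor)"
    proof cases
      case 1
      thus ?thesis by (simp only: iterate_poly_1) simp
    next
      case 2
      have "k = 1 \<or> k = 2" if "k dvd 2" for k :: nat
      proof -
        have "k \<le> 2" using that by (rule dvd_imp_le) simp
        moreover have "k \<noteq> 0" using that by (intro notI) simp
        ultimately show ?thesis by linarith
      qed
      hence "{k :: nat. k dvd 2} = {1, 2}" by auto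
      thus ?thesis unfolding 2 iterate_poly_2 period_2_factor(1) by simp
    qed
  qed auto
  thus ?thesis by simp
qed

lemma period_2_factor_root:
  assumes "poly period_2_factor z = 0"
  shows "poly f (poly f z) = z" "poly period_2_factor (poly f z) = 0"
proof -
  have "poly (f \<circ>\<^sub>p f - [:0, 1:]) z = 0"
    using assms by (simp only: period_2_factor(1) poly_mult mult_zero_right)
  thus z: "poly f (poly f z) = z" by (simp add: poly_pcompose)
  show "poly period_2_factor (poly f z) = 0"
  proof (cases "poly f z = z")
    case False
    have "poly (f \<circ>\<^sub>p f - [:0, 1:]) (poly f z) = 0"
      using z by (simp add: poly_pcompose)
    thus ?thesis using False z by (simp add: period_2_factor(1))
  qed (use assms in simp)
qed

lemma period_2_poly_pcompose:
  obtains h where "(f \<circ>\<^sub>p f - [:0, 1:]) \<circ>\<^sub>p f = (f \<circ>\<^sub>p f - [:0, 1:]) * h"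
    "\<And>z. poly (f \<circ>\<^sub>p f - [:0, 1:]) z = 0 \<Longrightarrow> poly h z = poly (pderiv f) z"
proof -
  let ?q = "f \<circ>\<^sub>p f - [:0, 1:]"
  obtain h where h: "f \<circ>\<^sub>p ([:0, 1:] + ?q) - f = ?q * h"
    "\<And>z. poly ?q z = 0 \<Longrightarrow> poly h z = poly (pderiv f) z"
    using pcompose_add_diff[of f ?q] by blast
  have "?q \<circ>\<^sub>p f = f \<circ>\<^sub>p ([:0, 1:] + ?q) - f"
    by (simp add: pcompose_diff pcompose_pCons pcompose_assoc)
  thus ?thesis using h that by metis
qed

text \<open>Away from the fixed points of \<open>f\<close> the order is that of q = f(f) - X. If the
  multiplier is not 1, it is 1 at both points. Otherwise f'(z) is nonzero, so q(f) has at z the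
  order of q at f(z), and by q(f) = q h also the order of q at z.\<close>

lemma order_period_2_factor_cycle:
  assumes z: "poly period_2_factor z = 0" and "poly f z \<noteq> z"
  shows "order (poly f z) period_2_factor = order z period_2_factor"
proof -
  let ?q = "f \<circ>\<^sub>p f - [:0, 1:]"
  note root = period_2_factor_root[OF z]
  have order: "order y period_2_factor = order y ?q" if "poly f y \<noteq> y" for y
  proof -
    have "order y (f - [:0, 1:]) = 0" using that by (intro order_0I) simp
    thus ?thesis unfolding period_2_factor(1)
      using period_2_poly_nonzero by (subst order_mult) (simp_all add: period_2_factor(1))
  qed
  have deriv: "poly (pderiv ?q) z = poly (pderiv f) (poly f z) * poly (pderiv f) z - 1"
    "poly (pderiv ?q) (poly f z) = poly (pderiv f) z * poly (pderiv f) (poly f z) - 1"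
    using root by (simp_all add: pderiv_diff poly_pderiv_pcompose pderiv_pCons)
  have "order (poly f z) ?q = order z ?q"
  proof (cases "poly (pderiv f) z * poly (pderiv f) (poly f z) = 1")
    case False
    hence "poly (pderiv ?q) z \<noteq> 0" "poly (pderiv ?q) (poly f z) \<noteq> 0"
      unfolding deriv by (simp_all add: mult.commute)
    moreover have "poly ?q z = 0" "poly ?q (poly f z) = 0"
      using root by (simp_all add: poly_pcompose)
    ultimately show ?thesis
      using order_eq_1[of ?q z] order_eq_1[of ?q "poly f z"] by presburger
  next
    case True
    hence nz: "poly (pderiv f) z \<noteq> 0" by auto
    obtain h where h: "?q \<circ>\<^sub>p f = ?q * h" "\<And>z. poly ?q z = 0 \<Longrightarrow> poly h z = poly (pderiv f) z"
      using period_2_poly_pcompose by blast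
    have "poly h z \<noteq> 0" using nz root by (subst h(2)) (simp_all add: poly_pcompose)
    hence "order z h = 0" "h \<noteq> 0" by (auto simp: order_0I)
    hence "order z (?q * h) = order z ?q"
      using period_2_poly_nonzero by (subst order_mult) auto
    thus ?thesis using order_pcompose[OF period_2_poly_nonzero nz] h(1) by simp
  qed
  thus ?thesis using order[of z] order[of "poly f z"] assms(2) root by simp
qed

text \<open>
  At a fixed point of multiplier \<^term>\<open>-1 :: 'a\<close> the second iterate commutes with
  \<^term>\<open>f\<close>, which acts as \<^term>\<open>-1 :: 'a\<close> on the first nonzero Taylor coefficient of
  \<^term>\<open>f \<circ>\<^sub>p f - [:0, 1:]\<close>; its order is therefore odd.
\<close>

lemma even_order_period_2_factor_fixed:
  assumes z: "poly period_2_factor z = 0" and "poly f z = z"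
  shows "even (order z period_2_factor)"
proof -
  let ?q = "f \<circ>\<^sub>p f - [:0, 1:]" and ?X = "[:-z, 1:]"
  have deriv: "poly (pderiv f) z = -1"
    using period_2_factor(2)[OF assms(2)] z by (simp add: eq_neg_iff_add_eq_0 add.commute)
  have "order z (f - [:0, 1:]) = 1"
    using deriv assms(2) by (intro order_eq_1) (simp_all add: pderiv_diff pderiv_pCons)
  hence order: "order z ?q = Suc (order z period_2_factor)"
    unfolding period_2_factor(1)
    using period_2_poly_nonzero by (subst order_mult) (simp_all add: period_2_factor(1))
  obtain s where s: "?q = ?X ^ order z ?q * s" "\<not> ?X dvd s"
    using order_decomp[OF period_2_poly_nonzero] by blast
  define k where "k = order z ?q"
  have sz: "poly s z \<noteq> 0" using s(2) by (simp add: poly_eq_0_iff_dvd)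
  have "?X dvd f - [:z:]" using assms(2) by (simp add: poly_eq_0_iff_dvd[symmetric])
  then obtain t where t: "f - [:z:] = ?X * t" by (elim dvdE)
  have "pderiv f = pderiv (f - [:z:])" by (simp add: pderiv_diff pderiv_pCons)
  hence "poly (pderiv (?X * t)) z = -1" using deriv unfolding t by simp
  hence tz: "poly t z = -1" by (simp add: pderiv_mult pderiv_pCons del: mult_pCons_left)
  obtain h where h: "?q \<circ>\<^sub>p f = ?q * h" "\<And>z. poly ?q z = 0 \<Longrightarrow> poly h z = poly (pderiv f) z"
    using period_2_poly_pcompose by blast
  have "?X \<circ>\<^sub>p f = ?X * t" unfolding t[symmetric] by (simp add: pcompose_pCons)
  hence "?q \<circ>\<^sub>p f = (?X * t) ^ k * (s \<circ>\<^sub>p f)"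
    by (subst s(1)) (simp only: pcompose_mult pcompose_power_left k_def)
  also have "\<dots> = ?X ^ k * (t ^ k * (s \<circ>\<^sub>p f))"
    by (simp only: power_mult_distrib mult.assoc)
  also have "?q \<circ>\<^sub>p f = ?X ^ k * (s * h)"
    unfolding h(1) by (subst s(1)) (simp only: mult.assoc k_def)
  \<comment> \<open>Cancelling \<open>?X ^ k\<close> and evaluating at \<open>z\<close> compares
    leading Taylor coefficients: t(z)^k s(z) = s(z) h(z), where t(z) = h(z) = -1.\<close>
  finally have "?X ^ k * (s * h) = ?X ^ k * (t ^ k * (s \<circ>\<^sub>p f))" .
  hence "t ^ k * (s \<circ>\<^sub>p f) = s * h" by simp
  hence "poly (t ^ k * (s \<circ>\<^sub>p f)) z = poly (s * h) z" by simp
  moreover have "poly h z = -1" using assms(2) deriv by (subst h(2)) (simp_all add: poly_pcompose)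
  ultimately have "(-1) ^ k * poly s z = - poly s z"
    using tz assms(2) by (simp add: poly_pcompose)
  hence "odd k" using sz by (cases "even k") (auto simp: eq_neg_iff_add_eq_0 mult_2[symmetric])
  thus ?thesis using order by (simp add: k_def)
qed

text \<open>The map \<open>poly f\<close> is an involution on the roots of
  \<open>period_2_factor\<close>, which gives a square root; of the two square roots exactly one is
  monic in characteristic 0. The definite description is therefore meaningful.\<close>

lemma multiplier_poly_2:
  "lead_coeff (multiplier_poly f 2) = 1 \<and> multiplier_poly f 2 ^ 2 =
     (\<Prod>z\<in>#proots (dynatomic f 2). [:- poly (pderiv (iterate_poly f 2)) z, 1:])"
  unfolding multiplier_poly_def
proof (rule theI')
  let ?h = "\<lambda>z. [:- poly (pderiv (iterate_poly f 2)) z, 1:]"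
  let ?Z = "{z. poly period_2_factor z = 0}"
  have "\<exists>p. lead_coeff p = 1 \<and> p ^ 2 = (\<Prod>z\<in>?Z. ?h z ^ order z period_2_factor)"
  proof (rule involution_prod_square[where \<sigma> = "poly f"])
    show "finite ?Z" using period_2_factor_nonzero by (rule poly_roots_finite)
    fix z assume "z \<in> ?Z"
    hence z: "poly period_2_factor z = 0" by simp
    show "poly f z \<in> ?Z" "poly f (poly f z) = z"
      using period_2_factor_root[OF z] by simp_all
    show "?h (poly f z) = ?h z"
      using period_2_factor_root[OF z] by (simp only: iterate_poly_2 poly_pderiv_pcompose) simp
    show "order (poly f z) period_2_factor = order z period_2_factor"
      using order_period_2_factor_cycle[OF z] by (cases "poly f z = z") auto
    show "even (order z period_2_factor)" if "poly f z = z"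
      using even_order_period_2_factor_fixed[OF z that] .
  qed simp
  then obtain p where p: "lead_coeff p = 1" "p ^ 2 = (\<Prod>z\<in>#proots (dynatomic f 2). ?h z)"
    using period_2_factor_nonzero by (auto simp: dynatomic_2 image_prod_mset_multiplicity)
  show "\<exists>!P. lead_coeff P = 1 \<and> P ^ 2 = (\<Prod>z\<in>#proots (dynatomic f 2). ?h z)"
  proof (rule ex1I[of _ p])
    fix P assume P: "lead_coeff P = 1 \<and> P ^ 2 = (\<Prod>z\<in>#proots (dynatomic f 2). ?h z)"
    hence "P ^ 2 = p ^ 2" using p by simp
    hence "P = p \<or> P = - p" by (simp add: power2_eq_iff)
    moreover have "P \<noteq> - p"
    proof
      assume "P = - p"
      hence "lead_coeff P = - 1" using p by simp
      thus False using P by simp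
    qed
    ultimately show "P = p" by blast
  qed (use p in blast)
qed

lemma fixed_multiplier_in_spectrum:
  "set_mset (multiplier_spectrum f 1) = {poly (pderiv f) z |z. poly f z = z}"
  unfolding multiplier_spectrum_1 using fixed_poly_nonzero by auto

lemma cycle_multiplier_in_spectrum:
  assumes "poly f (poly f z) = z" "poly f z \<noteq> z"
  shows "poly (pderiv f) z * poly (pderiv f) (poly f z) \<in># multiplier_spectrum f 2"
proof -
  let ?mu = "poly (pderiv f) z * poly (pderiv f) (poly f z)"
  have "poly (f \<circ>\<^sub>p f - [:0, 1:]) z = 0" using assms by (simp add: poly_pcompose)
  hence "poly period_2_factor z = 0" using assms(2) by (simp add: period_2_factor(1))
  hence "z \<in># proots (dynatomic f 2)" using period_2_factor_nonzero by (simp add: dynatomic_2)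
  hence "[:- poly (pderiv (iterate_poly f 2)) z, 1:] dvd multiplier_poly f 2 ^ 2"
    unfolding multiplier_poly_2[THEN conjunct2] by (intro dvd_prod_mset) auto
  moreover have "poly (pderiv (iterate_poly f 2)) z = ?mu"
    by (simp add: iterate_poly_2 poly_pderiv_pcompose)
  ultimately have "poly (multiplier_poly f 2 ^ 2) ?mu = 0"
    by (metis poly_eq_0_iff_dvd)
  hence "poly (multiplier_poly f 2) ?mu = 0" by simp
  moreover have "multiplier_poly f 2 \<noteq> 0" using multiplier_poly_2 by auto
  ultimately show ?thesis by (simp add: multiplier_spectrum_def)
qed

lemma max_multiplier_rate_ge:
  assumes "\<mu> \<in># multiplier_spectrum f p"
  shows "ereal (1 / real p) * log_abs v \<mu> \<le> max_multiplier_rate v f p"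
  unfolding max_multiplier_rate_def using assms by (intro Max_ge) auto

end

section \<open>Escape rates\<close>

lemma log_plus_nonneg [simp]: "log_plus t \<ge> 0"
  by (simp add: log_plus_def)

lemma exp_log_plus: "exp (log_plus t) = max 1 t"
  by (simp add: log_plus_def)

lemma log_plus_le_iff:
  assumes "C \<ge> 0"
  shows "log_plus t \<le> C \<longleftrightarrow> t \<le> exp C"
proof -
  have "log_plus t \<le> C \<longleftrightarrow> max 1 t \<le> exp C"
    unfolding exp_log_plus[symmetric] by simp
  thus ?thesis using assms by simp
qed

locale valued_field =
  fixes v :: "'a :: {alg_closed_field, field_char_0} \<Rightarrow> real"
  assumes abs_v: "absolute_value v"
begin

lemma v_nonneg [simp]: "v x \<ge> 0"
  and v_eq_0_iff [simp]: "v x = 0 \<longleftrightarrow> x = 0"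
  and v_mult: "v (x * y) = v x * v y"
  and v_add: "v (x + y) \<le> v x + v y"
  using abs_v by (auto simp: absolute_value_def)

lemma v_pos: "x \<noteq> 0 \<Longrightarrow> v x > 0"
  using v_nonneg[of x] by (simp add: order_less_le)

lemma v_0 [simp]: "v 0 = 0"
  by simp

lemma v_1 [simp]: "v 1 = 1"
  using v_mult[of 1 1] v_eq_0_iff[of 1] by simp

lemma v_minus [simp]: "v (- x) = v x"
proof -
  have "v (-1) * v (-1) = 1" using v_mult[of "-1" "-1"] by simp
  hence "v (-1) = 1" using v_nonneg[of "-1"]
    by (metis abs_of_nonneg power2_eq_square real_sqrt_abs real_sqrt_one)
  thus ?thesis using v_mult[of "-1" x] by simp
qed

lemma v_diff: "v (x - y) \<le> v x + v y"
  using v_add[of x "-y"] by simp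

lemma v_power: "v (x ^ n) = v x ^ n"
  by (induction n) (simp_all add: v_mult)

lemma v_inverse: "v (inverse x) = inverse (v x)"
proof (cases "x = 0")
  case False
  hence "v x * v (inverse x) = 1" using v_mult[of x "inverse x"] by simp
  thus ?thesis by (metis inverse_unique)
qed simp

lemma v_divide: "v (x / y) = v x / v y"
  by (simp add: divide_inverse v_mult v_inverse)

lemma v_sum: "v (sum f I) \<le> (\<Sum>i\<in>I. v (f i))"
proof (induction I rule: infinite_finite_induct)
  case (insert i I)
  thus ?case using v_add[of "f i" "sum f I"] by simp
qed simp_all


lemma log_plus_poly_le:
  obtains C where "C \<ge> 0" "\<And>z. log_plus (v (poly f z)) \<le> C + real (degree f) * log_plus (v z)"
proof -
  define K where "K = (\<Sum>i\<le>degree f. v (coeff f i))"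
  have K: "K \<ge> 0" unfolding K_def by (intro sum_nonneg) auto
  have "log_plus (v (poly f z)) \<le> log_plus K + real (degree f) * log_plus (v z)" for z
  proof -
    let ?m = "max 1 (v z)"
    have "v (poly f z) \<le> (\<Sum>i\<le>degree f. v (coeff f i * z ^ i))"
      unfolding poly_altdef by (rule v_sum)
    also have "\<dots> \<le> (\<Sum>i\<le>degree f. v (coeff f i) * ?m ^ degree f)"
    proof (rule sum_mono)
      fix i assume "i \<in> {..degree f}"
      hence "v z ^ i \<le> ?m ^ i" "?m ^ i \<le> ?m ^ degree f"
        by (auto intro!: power_mono power_increasing)
      thus "v (coeff f i * z ^ i) \<le> v (coeff f i) * ?m ^ degree f"
        unfolding v_mult v_power by (intro mult_left_mono) auto
    qed
    also have "\<dots> = K * ?m ^ degree f" by (simp add: K_def sum_distrib_right)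
    also have "\<dots> \<le> max 1 K * ?m ^ degree f" by (intro mult_right_mono) auto
    also have "\<dots> = exp (log_plus K + real (degree f) * log_plus (v z))"
      by (simp add: exp_add exp_of_nat_mult exp_log_plus)
    finally show ?thesis by (subst log_plus_le_iff) auto
  qed
  thus ?thesis using that[of "log_plus K"] by simp
qed

lemma green_function_convergent:
  assumes "degree f \<ge> 2"
  shows "convergent (\<lambda>n. 1 / real (degree f) ^ n * log_plus (v ((poly f ^^ n) z)))"
proof -
  let ?d = "real (degree f)"
  define a where "a = (\<lambda>n. 1 / ?d ^ n * log_plus (v ((poly f ^^ n) z)))"
  obtain C where C: "C \<ge> 0" "\<And>z. log_plus (v (poly f z)) \<le> C + ?d * log_plus (v z)"
    using log_plus_poly_le by blast
  \<comment> \<open>The correction makes the sequence decreasing, so only an upper bound for \<open>f\<close> is needed.\<close>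
  define b where "b = (\<lambda>n. a n + C * (1 / ?d) ^ n)"
  have d: "?d \<ge> 2" using assms by simp
  have "b (Suc n) \<le> b n" for n
  proof -
    have "?d ^ Suc n * b (Suc n) = log_plus (v (poly f ((poly f ^^ n) z))) + C"
      using d by (simp add: b_def a_def power_divide field_simps)
    also have "\<dots> \<le> 2 * C + ?d * log_plus (v ((poly f ^^ n) z))"
      using C(2)[of "(poly f ^^ n) z"] by simp
    also have "\<dots> \<le> ?d * C + ?d * log_plus (v ((poly f ^^ n) z))"
      using d C(1) by (intro add_right_mono mult_right_mono) auto
    also have "\<dots> = ?d ^ Suc n * b n"
      using d by (simp add: b_def a_def power_divide field_simps)
    finally show ?thesis using d by (simp add: mult_le_cancel_left)
  qed
  hence "decseq b" by (rule decseq_SucI)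
  moreover have "b n \<ge> 0" for n
    using C(1) d by (simp add: b_def a_def)
  ultimately obtain L where "b \<longlonglongrightarrow> L" using decseq_convergent[of b 0] by blast
  moreover have "(\<lambda>n. C * (1 / ?d) ^ n) \<longlonglongrightarrow> C * 0"
    using d by (intro tendsto_mult LIMSEQ_realpow_zero) auto
  ultimately have "(\<lambda>n. b n - C * (1 / ?d) ^ n) \<longlonglongrightarrow> L - C * 0"
    by (rule tendsto_diff)
  thus ?thesis unfolding b_def a_def by (auto simp: convergent_def)
qed

text \<open>\<open>F\<close> is X plus the product of X - a over its fixed points a. So |x| <= m
  with m >= S implies |F(x)| <= 2^(d+1) m^d, and this bound is iterated.\<close>

lemma green_function_le:
  assumes d: "degree f \<ge> 2" and F: "lead_coeff F = 1" "degree F = degree f"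
    and \<alpha>: "\<alpha> \<noteq> 0" "\<And>z. poly F (\<alpha> * (z - z\<^sub>0)) = \<alpha> * (poly f z - z\<^sub>0)"
    and S: "S \<ge> 1" "\<And>x. poly F x = x \<Longrightarrow> v x \<le> S" "v (\<alpha> * (z - z\<^sub>0)) \<le> S"
  shows "green_function v f z \<le> ln S + real (degree f + 1) * ln 2"
proof -
  let ?d = "real (degree f)" and ?c = "real (degree f + 1) * ln 2"
  have "degree (F - [:0, 1:]) = degree F" "lead_coeff (F - [:0, 1:]) = 1"
    using F d degree_diff_less[of "[:0, 1:]" F] by simp_all
  moreover from this have "F - [:0, 1:] \<noteq> 0" by auto
  ultimately obtain A where A: "size A = degree f" "F - [:0, 1:] = (\<Prod>x\<in>#A. [:-x, 1:])"
    using alg_closed_imp_factorization[of "F - [:0, 1:]"] F by auto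
  have A_le: "v a \<le> S" if "a \<in># A" for a
  proof -
    have "a \<in># proots (F - [:0, 1:])" using that by (simp only: A(2) proots_prod_linear)
    hence "poly (F - [:0, 1:]) a = 0" using \<open>F - [:0, 1:] \<noteq> 0\<close> by simp
    thus ?thesis using S(2) by simp
  qed
  have step: "v (poly F x) \<le> 2 ^ (degree f + 1) * m ^ degree f" if "m \<ge> S" "v x \<le> m" for x m
  proof -
    have "v (poly (\<Prod>x\<in>#B. [:-x, 1:]) x) \<le> (2 * m) ^ size B" if "\<And>b. b \<in># B \<Longrightarrow> v b \<le> S" for B
      using that
    proof (induction B)
      case (add b B)
      have "v (x - b) \<le> 2 * m"
        using v_diff[of x b] add.prems[of b] \<open>m \<ge> S\<close> \<open>v x \<le> m\<close> by simp
      moreover have "v (poly (\<Prod>x\<in>#B. [:-x, 1:]) x) \<le> (2 * m) ^ size B"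
        using add by simp
      ultimately have "v (x - b) * v (poly (\<Prod>x\<in>#B. [:-x, 1:]) x) \<le> 2 * m * (2 * m) ^ size B"
        using \<open>m \<ge> S\<close> S(1) by (intro mult_mono) auto
      thus ?case by (simp add: v_mult[symmetric] algebra_simps)
    qed simp
    from this[of A] have "v (poly (F - [:0, 1:]) x) \<le> (2 * m) ^ degree f"
      using A_le A by simp
    hence "v (x + poly (F - [:0, 1:]) x) \<le> m + (2 * m) ^ degree f"
      using v_add[of x "poly (F - [:0, 1:]) x"] that(2) by linarith
    hence "v (poly F x) \<le> m + (2 * m) ^ degree f" by simp
    moreover have "(2 * m) ^ 1 \<le> (2 * m) ^ degree f"
      using that(1) S(1) d by (intro power_increasing) auto
    hence "m \<le> (2 * m) ^ degree f" using that(1) S(1) by simp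
    ultimately have "v (poly F x) \<le> 2 * (2 * m) ^ degree f" by simp
    thus ?thesis by (simp add: power_mult_distrib)
  qed
  define y where "y n = \<alpha> * ((poly f ^^ n) z - z\<^sub>0)" for n
  have y_Suc: "y (Suc n) = poly F (y n)" for n by (simp add: y_def \<alpha>)
  \<comment> \<open>The subtracted \<open>?c\<close> closes the induction: with E = d^n (ln S + c),
    the inequality d (E - c) + c <= d E - c amounts to 2 c <= d c.\<close>
  have growth: "v (y n) \<le> exp (?d ^ n * (ln S + ?c) - ?c)" for n
  proof (induction n)
    case 0
    show ?case using S by (simp add: y_def)
  next
    case (Suc n)
    let ?E = "?d ^ n * (ln S + ?c) - ?c"
    have c: "?c \<ge> 0" by simp
    have "1 * (ln S + ?c) \<le> ?d ^ n * (ln S + ?c)"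
      using d S(1) c by (intro mult_right_mono one_le_power) auto
    hence "exp (ln S) \<le> exp ?E" by (subst exp_le_cancel_iff) simp
    hence "S \<le> exp ?E" using S(1) by simp
    from step[OF this Suc.IH] have "v (y (Suc n)) \<le> 2 ^ (degree f + 1) * exp ?E ^ degree f"
      by (simp add: y_Suc)
    also have "2 ^ (degree f + 1) = exp ?c"
      by (subst exp_of_nat_mult) simp
    also have "exp ?c * exp ?E ^ degree f = exp (?c + ?d * ?E)"
      by (simp add: exp_add exp_of_nat_mult)
    also have "\<dots> \<le> exp (?d ^ Suc n * (ln S + ?c) - ?c)"
    proof -
      have "2 * ?c \<le> ?d * ?c" using d c by (intro mult_right_mono) auto
      thus ?thesis by (subst exp_le_cancel_iff) (simp add: algebra_simps)
    qed
    finally show ?case .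
  qed
  \<comment> \<open>\<open>K\<close> accounts for the return from \<open>y n\<close> to the original
    coordinate and disappears in the limit after division by d^n.\<close>
  define K where "K = log_plus (v z\<^sub>0 + 1 / v \<alpha>)"
  have bound: "log_plus (v ((poly f ^^ n) z)) \<le> K + ?d ^ n * (ln S + ?c)" for n
  proof -
    let ?E = "?d ^ n * (ln S + ?c)"
    have E: "?E \<ge> 0" using S(1) by simp
    have "(poly f ^^ n) z = z\<^sub>0 + y n / \<alpha>" using \<alpha>(1) by (simp add: y_def)
    hence "v ((poly f ^^ n) z) \<le> v z\<^sub>0 + v (y n) / v \<alpha>"
      using v_add[of z\<^sub>0 "y n / \<alpha>"] by (simp add: v_divide)
    also have "v (y n) \<le> exp ?E"
      using growth[of n] by (rule order_trans) simp
    also have "v z\<^sub>0 + exp ?E / v \<alpha> \<le> (v z\<^sub>0 + 1 / v \<alpha>) * exp ?E"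
      using E mult_left_mono[of 1 "exp ?E" "v z\<^sub>0"] by (simp add: algebra_simps)
    also have "\<dots> \<le> max 1 (v z\<^sub>0 + 1 / v \<alpha>) * exp ?E"
      by (intro mult_right_mono) auto
    also have "\<dots> = exp (K + ?E)" by (simp add: K_def exp_add exp_log_plus)
    finally show ?thesis using E by (subst log_plus_le_iff) (auto simp: K_def divide_right_mono)
  qed
  have "(\<lambda>n. K * (1 / ?d) ^ n + (ln S + ?c)) \<longlonglongrightarrow> K * 0 + (ln S + ?c)"
    using d by (intro tendsto_add tendsto_mult LIMSEQ_realpow_zero) auto
  moreover have "(\<lambda>n. 1 / ?d ^ n * log_plus (v ((poly f ^^ n) z))) \<longlonglongrightarrow> green_function v f z"
    unfolding green_function_def using green_function_convergent[OF d]
    by (simp add: convergent_LIMSEQ_iff)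
  moreover have "1 / ?d ^ n * log_plus (v ((poly f ^^ n) z)) \<le> K * (1 / ?d) ^ n + (ln S + ?c)" for n
    using bound[of n] d by (simp add: field_simps power_divide)
  ultimately have "green_function v f z \<le> K * 0 + (ln S + ?c)"
    by (intro LIMSEQ_le) blast+
  thus ?thesis by simp
qed

end

text \<open>The affine coordinate sends a fixed point \<open>z\<^sub>0\<close> to 0, and
  \<open>\<alpha> ^ (degree f - 1) = lead_coeff f\<close> makes the conjugate monic. The last clause
  says that derivatives correspond, hence multipliers and critical points.\<close>

lemma exists_monic_conjugate:
  fixes f :: "'a :: {alg_closed_field, field_char_0} poly"
  assumes "degree f \<ge> 2"
  obtains F \<alpha> z\<^sub>0 where "\<alpha> \<noteq> 0" "lead_coeff F = 1" "degree F = degree f" "poly F 0 = 0"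
    "\<And>z. poly F (\<alpha> * (z - z\<^sub>0)) = \<alpha> * (poly f z - z\<^sub>0)"
    "\<And>z. poly (pderiv F) (\<alpha> * (z - z\<^sub>0)) = poly (pderiv f) z"
proof -
  have "degree (f - [:0, 1:]) = degree f"
    using assms degree_diff_less[of "[:0, 1:]" f] by simp
  then obtain z\<^sub>0 where z0: "poly f z\<^sub>0 = z\<^sub>0"
    using alg_closed_imp_poly_has_root[of "f - [:0, 1:]"] assms by auto
  obtain \<alpha> where \<alpha>: "\<alpha> ^ (degree f - 1) = lead_coeff f"
    using nth_root_exists[of "degree f - 1" "lead_coeff f"] assms by auto
  have "lead_coeff f \<noteq> 0" using assms by auto
  hence nz: "\<alpha> \<noteq> 0" using \<alpha> assms by (auto simp: zero_power)
  define F where "F = smult \<alpha> ((f - [:z\<^sub>0:]) \<circ>\<^sub>p [:z\<^sub>0, 1 / \<alpha>:])"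
  have deg: "degree (f - [:z\<^sub>0:]) = degree f" "lead_coeff (f - [:z\<^sub>0:]) = lead_coeff f"
    using assms degree_diff_less[of "[:z\<^sub>0:]" f] by simp_all
  have poly_F: "poly F (\<alpha> * (z - z\<^sub>0)) = \<alpha> * (poly f z - z\<^sub>0)" for z
    using nz by (simp add: F_def poly_pcompose)
  have "lead_coeff F = \<alpha> * (lead_coeff f * (1 / \<alpha>) ^ degree f)"
    using nz deg lead_coeff_comp[of "[:z\<^sub>0, 1 / \<alpha>:]" "f - [:z\<^sub>0:]"] by (simp add: F_def)
  also have "\<dots> = lead_coeff f / \<alpha> ^ (degree f - 1)"
    using nz assms power_Suc[of \<alpha> "degree f - 1"] by (simp add: power_divide)
  also have "\<dots> = 1" unfolding \<alpha> using \<open>lead_coeff f \<noteq> 0\<close> by simp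
  finally have lead: "lead_coeff F = 1" .
  moreover have "degree F = degree f"
    using nz deg by (simp add: F_def degree_pcompose)
  moreover have "poly F 0 = 0"
    using poly_F[of z\<^sub>0] z0 by simp
  moreover have "poly (pderiv F) (\<alpha> * (z - z\<^sub>0)) = poly (pderiv f) z" for z
    using nz by (simp add: F_def pderiv_smult pderiv_pcompose poly_pcompose pderiv_diff pderiv_pCons)
  ultimately show ?thesis using that nz poly_F by blast
qed

section \<open>Comparison of multipliers and escape rates\<close>

text \<open>The sum collects the residues of f' / (f - X) at its finite poles, which are simple
  because no multiplier is 1; the degree is minus the residue at infinity.\<close>

lemma multiplier_residue_identity:
  fixes f :: "'a :: {alg_closed_field, field_char_0} poly"
  assumes d: "degree f \<ge> 2" and ne_1: "\<And>z. poly f z = z \<Longrightarrow> poly (pderiv f) z \<noteq> 1"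
  defines "Z \<equiv> {z. poly f z = z}"
  shows "finite Z" "card Z = degree f"
    "of_nat (degree f) = (\<Sum>z\<in>Z. poly (pderiv f) z / (poly (pderiv f) z - 1))"
proof -
  define p where "p = f - [:0, 1:]"
  have p: "degree p = degree f" "lead_coeff p = lead_coeff f"
    unfolding p_def using d degree_diff_less[of "[:0, 1:]" f] by simp_all
  hence nz: "p \<noteq> 0" using d by auto
  have Z: "Z = {z. poly p z = 0}" by (simp add: Z_def p_def)
  show fin: "finite Z" unfolding Z using nz by (rule poly_roots_finite)
  have deriv: "poly (pderiv p) z = poly (pderiv f) z - 1" for z
    by (simp add: p_def pderiv_diff pderiv_pCons)
  have deriv_nz: "poly (pderiv p) z \<noteq> 0" if "z \<in> Z" for z
    using ne_1 that by (simp add: deriv Z_def)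
  obtain A where A: "size A = degree p" "p = smult (lead_coeff p) (\<Prod>x\<in>#A. [:-x, 1:])"
    using alg_closed_imp_factorization[OF nz] by blast
  have "proots p = A"
    using nz A(2) proots_prod_linear[of A] proots_smult[of "lead_coeff p" "\<Prod>x\<in>#A. [:-x, 1:]"] by simp
  hence "degree f = size (proots p)" using A(1) p by simp
  also have "\<dots> = (\<Sum>z\<in>Z. order z p)"
    using nz by (simp add: size_multiset_overloaded_eq Z)
  also have "\<dots> = (\<Sum>z\<in>Z. 1)"
    using deriv_nz by (intro sum.cong order_eq_1) (auto simp: Z)
  finally show card: "card Z = degree f" by simp
  \<comment> \<open>\<open>L z\<close> is p / (X - z), up to a constant the Lagrange basis
    polynomial at \<open>z\<close>.\<close>
  define L where "L z = synthetic_div p z" for z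
  have L: "p = [:-z, 1:] * L z" if "z \<in> Z" for z
    using synthetic_div_correct'[of z p] that by (simp add: L_def Z)
  have L_eval: "poly (L z) w = (if w = z then poly (pderiv p) z else 0)" if "z \<in> Z" "w \<in> Z" for z w
  proof (cases "w = z")
    case True
    have "poly (pderiv p) z = poly (pderiv ([:-z, 1:] * L z)) z" using L[OF that(1)] by simp
    also have "\<dots> = poly (L z) z" by (simp add: pderiv_mult pderiv_pCons del: mult_pCons_left)
    finally show ?thesis using True by simp
  next
    case False
    have "poly ([:-z, 1:] * L z) w = 0" using L[OF that(1)] that(2) by (simp add: Z)
    thus ?thesis using False by (simp del: mult_pCons_left)
  qed
  have degL: "degree (L z) = degree f - 1" for z
    by (simp add: L_def degree_synthetic_div p)
  have leadL: "coeff (L z) (degree f - 1) = lead_coeff f" if "z \<in> Z" for z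
  proof -
    have "lead_coeff ([:-z, 1:] * L z) = lead_coeff (L z)"
      by (simp add: lead_coeff_mult del: mult_pCons_left)
    thus ?thesis using L[OF that] p degL by metis
  qed
  define c where "c z = poly (pderiv f) z / poly (pderiv p) z" for z
  \<comment> \<open>Lagrange interpolation; the identity is the comparison of the coefficients of index \<open>degree f - 1\<close>.\<close>
  have "pderiv f = (\<Sum>z\<in>Z. smult (c z) (L z))"
  proof (rule poly_eqI_degree[where A = Z])
    fix w assume w: "w \<in> Z"
    have "poly (\<Sum>z\<in>Z. smult (c z) (L z)) w = (\<Sum>z\<in>Z. if w = z then c z * poly (pderiv p) z else 0)"
      using w by (simp add: poly_sum L_eval if_distrib cong: if_cong)
    also have "\<dots> = poly (pderiv f) w"
      using fin w deriv_nz[OF w] by (simp add: c_def)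
    finally show "poly (pderiv f) w = poly (\<Sum>z\<in>Z. smult (c z) (L z)) w" ..
  next
    show "degree (pderiv f) < card Z" using d by (simp add: card degree_pderiv)
    have "degree (\<Sum>z\<in>Z. smult (c z) (L z)) \<le> degree f - 1"
      using degL by (intro degree_sum_le[OF fin]) (simp add: degree_smult_le[THEN order_trans])
    thus "degree (\<Sum>z\<in>Z. smult (c z) (L z)) < card Z" using d by (simp add: card)
  qed
  hence "coeff (pderiv f) (degree f - 1) = (\<Sum>z\<in>Z. c z * lead_coeff f)"
    using leadL by (simp add: coeff_sum)
  moreover have "coeff (pderiv f) (degree f - 1) = of_nat (degree f) * lead_coeff f"
    using d by (simp add: coeff_pderiv del: of_nat_Suc)
  moreover have "lead_coeff f \<noteq> 0" using d by auto
  ultimately have "of_nat (degree f) = (\<Sum>z\<in>Z. c z)"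
    by (simp add: sum_distrib_right[symmetric])
  thus "of_nat (degree f) = (\<Sum>z\<in>Z. poly (pderiv f) z / (poly (pderiv f) z - 1))"
    by (simp add: c_def deriv)
qed

context valued_field
begin

text \<open>If all multipliers were below \<open>\<delta>\<close>, at most 1/2, they would differ
  from 1 by at least 1/2 and each term of the residue identity would be below
  \<open>2 * \<delta>\<close>. The second entry of the minimum then makes the sum too small to equal
  d.\<close>

lemma exists_fixed_multiplier_ge:
  assumes "d \<ge> 2"
  obtains \<delta> where "0 < \<delta>" "\<delta> < 1"
    "\<And>f. degree f = d \<Longrightarrow> \<exists>z. poly f z = z \<and> v (poly (pderiv f) z) \<ge> \<delta>"
proof -
  define \<delta> where "\<delta> = min (1 / 2) (v (of_nat d) / (2 * real d))"
  have vd: "v (of_nat d) > 0" using assms by (intro v_pos) simp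
  have \<delta>: "0 < \<delta>" "\<delta> < 1" "\<delta> \<le> 1 / 2" using vd assms by (auto simp: \<delta>_def)
  have "\<exists>z. poly f z = z \<and> v (poly (pderiv f) z) \<ge> \<delta>" if f: "degree f = d" for f
  proof (rule ccontr)
    assume "\<not> ?thesis"
    hence small: "v (poly (pderiv f) z) < \<delta>" if "poly f z = z" for z
      using that by force
    have "poly (pderiv f) z \<noteq> 1" if "poly f z = z" for z
      using small[OF that] \<delta> by auto
    note id = multiplier_residue_identity[of f, OF _ this]
    let ?Z = "{z. poly f z = z}"
    have "of_nat d = (\<Sum>z\<in>?Z. poly (pderiv f) z / (poly (pderiv f) z - 1))"
      using id(3) f assms by simp
    hence "v (of_nat d) \<le> (\<Sum>z\<in>?Z. v (poly (pderiv f) z / (poly (pderiv f) z - 1)))"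
      by (simp only: v_sum)
    also have "\<dots> < (\<Sum>z\<in>?Z. 2 * \<delta>)"
    proof (rule sum_strict_mono)
      show "finite ?Z" using id(1) f assms by simp
      have "card ?Z \<noteq> 0" using id(2) f assms by simp
      thus "?Z \<noteq> {}" by (metis card.empty)
      fix z assume "z \<in> ?Z"
      hence z: "v (poly (pderiv f) z) < \<delta>" using small by simp
      have "v 1 \<le> v (poly (pderiv f) z) + v (poly (pderiv f) z - 1)"
        using v_diff[of "poly (pderiv f) z" "poly (pderiv f) z - 1"] by simp
      hence half: "1 / 2 \<le> v (poly (pderiv f) z - 1)" using z \<delta> by simp
      have "v (poly (pderiv f) z) / v (poly (pderiv f) z - 1) \<le> v (poly (pderiv f) z) / (1 / 2)"
        using half by (intro divide_left_mono) auto
      thus "v (poly (pderiv f) z / (poly (pderiv f) z - 1)) < 2 * \<delta>"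
        using z by (simp add: v_divide)
    qed
    also have "\<dots> = real d * (2 * \<delta>)" using id(2) f assms by simp
    also have "\<dots> \<le> real d * (2 * (v (of_nat d) / (2 * real d)))"
      by (intro mult_left_mono) (auto simp: \<delta>_def)
    also have "\<dots> = v (of_nat d)" using assms by simp
    finally show False by simp
  qed
  thus ?thesis using that \<delta> by blast
qed

lemma finite_critical_points:
  fixes f :: "'a poly"
  assumes "degree f \<ge> 2"
  shows "finite {c. poly (pderiv f) c = 0}" "{c. poly (pderiv f) c = 0} \<noteq> {}"
proof -
  have "pderiv f \<noteq> 0" using assms by (simp add: pderiv_eq_0_iff)
  thus "finite {c. poly (pderiv f) c = 0}" by (rule poly_roots_finite)
  show "{c. poly (pderiv f) c = 0} \<noteq> {}"
    using alg_closed_imp_poly_has_root[of "pderiv f"] assms by (auto simp: degree_pderiv)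
qed

text \<open>\<open>p\<close> is a fixed or critical point of largest absolute value, so
  \<open>max 1 (v p)\<close> is an admissible \<open>S\<close> in \<open>green_function_le\<close>
  for all critical points at once.\<close>

lemma exists_conjugate_bounding_escape_rate:
  assumes d: "degree f \<ge> 2"
  obtains F \<alpha> z\<^sub>0 p where "\<alpha> \<noteq> 0" "lead_coeff F = 1" "degree F = degree f" "poly F 0 = 0"
    "\<And>z. poly F (\<alpha> * (z - z\<^sub>0)) = \<alpha> * (poly f z - z\<^sub>0)"
    "\<And>z. poly (pderiv F) (\<alpha> * (z - z\<^sub>0)) = poly (pderiv f) z"
    "poly F p = p \<or> poly (pderiv F) p = 0"
    "max_escape_rate v f \<le> ln (max 1 (v p)) + real (degree f + 1) * ln 2"
proof -
  obtain F \<alpha> z\<^sub>0 where F: "\<alpha> \<noteq> 0" "lead_coeff F = 1" "degree F = degree f" "poly F 0 = 0"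
    "\<And>z. poly F (\<alpha> * (z - z\<^sub>0)) = \<alpha> * (poly f z - z\<^sub>0)"
    "\<And>z. poly (pderiv F) (\<alpha> * (z - z\<^sub>0)) = poly (pderiv f) z"
    using exists_monic_conjugate[OF d] by metis
  define P where "P = {p. poly F p = p \<or> poly (pderiv F) p = 0}"
  have "F - [:0, 1:] \<noteq> 0" using d F(3) degree_diff_less(1)[of "[:0, 1:]" F] by auto
  hence "finite {x. poly (F - [:0, 1:]) x = 0}" by (rule poly_roots_finite)
  hence "finite ({x. poly F x = x} \<union> {x. poly (pderiv F) x = 0})"
    using finite_critical_points(1)[of F] d F(3) by simp
  hence fin: "finite P" by (simp add: P_def Un_def)
  have ne: "P \<noteq> {}" using F(4) by (auto simp: P_def)
  have "Max (v ` P) \<in> v ` P" using fin ne by (intro Max_in) auto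
  then obtain p where "p \<in> P" "v p = Max (v ` P)" by auto
  hence p: "p \<in> P" "\<And>x. x \<in> P \<Longrightarrow> v x \<le> v p"
    using fin by simp_all
  have "green_function v f c \<le> ln (max 1 (v p)) + real (degree f + 1) * ln 2"
    if "poly (pderiv f) c = 0" for c
  proof (rule green_function_le[OF d F(2,3,1,5)])
    show "v x \<le> max 1 (v p)" if "poly F x = x" for x
      using p(2)[of x] that by (auto simp: P_def)
    show "v (\<alpha> * (c - z\<^sub>0)) \<le> max 1 (v p)"
      using p(2)[of "\<alpha> * (c - z\<^sub>0)"] that F(6)[of c] by (auto simp: P_def)
  qed simp
  hence "max_escape_rate v f \<le> ln (max 1 (v p)) + real (degree f + 1) * ln 2"
    unfolding max_escape_rate_def using finite_critical_points[OF d] by (intro Max.boundedI) auto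
  thus ?thesis using that F p(1) by (auto simp: P_def)
qed

lemma exists_multiplier_ge_escape_rate:
  assumes d: "d \<ge> 2"
  obtains A C :: real where "A > 0"
    "\<And>f. degree f = d \<Longrightarrow> max_escape_rate v f \<ge> C \<Longrightarrow>
       (\<exists>z. poly f z = z \<and> v (poly (pderiv f) z) > exp (A * max_escape_rate v f)) \<or>
       (d \<ge> 4 \<and> (\<exists>z. poly f (poly f z) = z \<and> poly f z \<noteq> z \<and>
          v (poly (pderiv f) z * poly (pderiv f) (poly f z)) > exp (A * max_escape_rate v f)))"
proof -
  define good where "good A f \<longleftrightarrow>
       (\<exists>z. poly f z = z \<and> v (poly (pderiv f) z) > exp (A * max_escape_rate v f)) \<or>
       (d \<ge> 4 \<and> (\<exists>z. poly f (poly f z) = z \<and> poly f z \<noteq> z \<and>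
          v (poly (pderiv f) z * poly (pderiv f) (poly f z)) > exp (A * max_escape_rate v f)))" for A f
  have "\<exists>A>0. \<exists>C. \<forall>f. degree f = d \<longrightarrow> max_escape_rate v f \<ge> C \<longrightarrow> good A f"
  proof (rule ccontr)
    assume neg: "\<not> ?thesis"
    \<comment> \<open>\<open>f n\<close> refutes the pair A = 1/(n+1), C = n. So the escape rates
      tend to infinity, while the multipliers in question are at most exp (M n / (n+1)), which is
      exp (o(M n)).\<close>
    have "\<exists>f. degree f = d \<and> max_escape_rate v f \<ge> real n \<and> \<not> good (1 / real (Suc n)) f" for n
      using neg by (metis zero_less_divide_1_iff of_nat_0_less_iff zero_less_Suc)
    then obtain f where f: "\<And>n. degree (f n) = d" "\<And>n. max_escape_rate v (f n) \<ge> real n"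
      "\<And>n. \<not> good (1 / real (Suc n)) (f n)" by metis
    define M where "M n = max_escape_rate v (f n)" for n
    have M: "filterlim M at_top sequentially"
      using f(2) by (intro filterlim_at_top_mono[OF filterlim_real_sequentially]) (simp add: M_def)
    have M_nonneg: "M n \<ge> 0" for n using f(2)[of n] by (simp add: M_def)
    have "\<exists>F \<alpha> z\<^sub>0 p. \<alpha> \<noteq> 0 \<and> lead_coeff F = 1 \<and> degree F = d \<and> poly F 0 = 0 \<and>
      (\<forall>z. poly F (\<alpha> * (z - z\<^sub>0)) = \<alpha> * (poly (f n) z - z\<^sub>0)) \<and>
      (\<forall>z. poly (pderiv F) (\<alpha> * (z - z\<^sub>0)) = poly (pderiv (f n)) z) \<and>
      (poly F p = p \<or> poly (pderiv F) p = 0) \<and>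
      M n \<le> ln (max 1 (v p)) + real (d + 1) * ln 2" for n
      using exists_conjugate_bounding_escape_rate[of "f n"] d f(1)[of n] unfolding M_def by metis
    then obtain F \<alpha> z\<^sub>0 p where F: "\<And>n. \<alpha> n \<noteq> 0" "\<And>n. lead_coeff (F n) = 1" "\<And>n. degree (F n) = d"
      "\<And>n. poly (F n) 0 = 0"
      "\<And>n z. poly (F n) (\<alpha> n * (z - z\<^sub>0 n)) = \<alpha> n * (poly (f n) z - z\<^sub>0 n)"
      "\<And>n z. poly (pderiv (F n)) (\<alpha> n * (z - z\<^sub>0 n)) = poly (pderiv (f n)) z"
      "\<And>n. poly (F n) (p n) = p n \<or> poly (pderiv (F n)) (p n) = 0"
      "\<And>n. M n \<le> ln (max 1 (v (p n))) + real (d + 1) * ln 2" by metis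
    have coord: "\<exists>z. x = \<alpha> n * (z - z\<^sub>0 n)" for x n
      using F(1)[of n] by (intro exI[of _ "z\<^sub>0 n + x / \<alpha> n"]) simp
    have inj: "\<alpha> n * (z - z\<^sub>0 n) = \<alpha> n * (w - z\<^sub>0 n) \<longleftrightarrow> z = w" for n z w
      using F(1) by simp
    have rate: "\<forall>\<^sub>F n in sequentially. exp (1 / real (Suc n) * M n) \<le> exp (\<epsilon> * M n)" if "\<epsilon> > 0" for \<epsilon>
    proof -
      have "\<forall>\<^sub>F n in sequentially. inverse (real (Suc n)) < \<epsilon>"
        using order_tendstoD(2)[OF LIMSEQ_inverse_real_of_nat that] .
      thus ?thesis
      proof eventually_elim
        case (elim n)
        hence "1 / real (Suc n) * M n \<le> \<epsilon> * M n"
          using M_nonneg[of n] by (intro mult_right_mono) (simp_all add: inverse_eq_divide)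
        thus ?case by (simp only: exp_le_cancel_iff)
      qed
    qed
    \<comment> \<open>An exponent below 1 contradicts the bound of M n by the logarithm of
      \<open>max 1 (v (p n))\<close> up to a constant; with 1/2 this happens once M n > 2 (d + 1) ln
      2.\<close>
    have bound: "\<forall>\<^sub>F n in nat_ultrafilter. v (p n) \<le> exp (1 / 2 * M n)"
    proof (rule growth_of_fixed_and_critical_points[OF abs_v M F(2,3,4) d])
      fix \<epsilon> :: real assume "\<epsilon> > 0"
      from rate[OF this] show "\<forall>\<^sub>F n in sequentially. \<forall>x. poly (F n) x = x \<longrightarrow>
          v (poly (pderiv (F n)) x) \<le> exp (\<epsilon> * M n)"
      proof eventually_elim
        case (elim n)
        show ?case
        proof (intro allI impI)
          fix x assume x: "poly (F n) x = x"
          obtain z where z: "x = \<alpha> n * (z - z\<^sub>0 n)" using coord by blast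
          have "poly (f n) z = z" using x unfolding z F(5) inj .
          hence "v (poly (pderiv (f n)) z) \<le> exp (1 / real (Suc n) * M n)"
            using f(3)[of n] unfolding good_def M_def not_less[symmetric] by blast
          thus "v (poly (pderiv (F n)) x) \<le> exp (\<epsilon> * M n)"
            unfolding z F(6) using elim by (rule order_trans)
        qed
      qed
    next
      fix \<epsilon> :: real assume d4: "d \<ge> 4" and "\<epsilon> > 0"
      from rate[OF this(2)] show "\<forall>\<^sub>F n in sequentially. \<forall>x. poly (F n) (poly (F n) x) = x \<longrightarrow>
          poly (F n) x \<noteq> x \<longrightarrow>
          v (poly (pderiv (F n)) x * poly (pderiv (F n)) (poly (F n) x)) \<le> exp (\<epsilon> * M n)"
      proof eventually_elim
        case (elim n)
        show ?case
        proof (intro allI impI)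
          fix x assume x: "poly (F n) (poly (F n) x) = x" "poly (F n) x \<noteq> x"
          obtain z where z: "x = \<alpha> n * (z - z\<^sub>0 n)" using coord by blast
          have "poly (f n) (poly (f n) z) = z" "poly (f n) z \<noteq> z"
            using x unfolding z F(5) inj by blast+
          hence "v (poly (pderiv (f n)) z * poly (pderiv (f n)) (poly (f n) z))
              \<le> exp (1 / real (Suc n) * M n)"
            using f(3)[of n] d4 unfolding good_def M_def not_less[symmetric] by blast
          thus "v (poly (pderiv (F n)) x * poly (pderiv (F n)) (poly (F n) x)) \<le> exp (\<epsilon> * M n)"
            unfolding z F(5,6) using elim by (rule order_trans)
        qed
      qed
    qed (use F(7) in simp_all)
    have "\<forall>\<^sub>F n in nat_ultrafilter. M n > 2 * (real (d + 1) * ln 2)"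
      using M by (intro eventually_ultra_sequentially) (simp add: filterlim_at_top_dense)
    with bound have "\<forall>\<^sub>F n in nat_ultrafilter. False"
    proof eventually_elim
      case (elim n)
      have "max 1 (v (p n)) \<le> exp (1 / 2 * M n)"
        using elim(1) M_nonneg[of n] by simp
      hence "ln (max 1 (v (p n))) \<le> ln (exp (1 / 2 * M n))"
        by (subst ln_le_cancel_iff) auto
      thus False using F(8)[of n] elim(2) by simp
    qed
    thus False using nat_ultrafilter(2) by simp
  qed
  then obtain A C where "A > 0" "\<And>f. degree f = d \<Longrightarrow> max_escape_rate v f \<ge> C \<Longrightarrow> good A f"
    by blast
  thus ?thesis using that[of A C] unfolding good_def by blast
qed

lemma max_multiplier_rate_1_ge:
  assumes "degree f \<ge> 2" "poly f z = z" "v (poly (pderiv f) z) \<ge> exp r"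
  shows "max_multiplier_rate v f 1 \<ge> ereal r"
proof -
  interpret iterated_polynomial f by unfold_locales fact
  let ?\<mu> = "poly (pderiv f) z"
  have "exp r \<le> exp (ln (v ?\<mu>))" "?\<mu> \<noteq> 0"
    using assms(3) v_pos[of ?\<mu>] exp_gt_zero[of r] by (auto simp del: exp_gt_zero)
  hence "ereal r \<le> log_abs v ?\<mu>" by (simp add: log_abs_def)
  also have "\<dots> = ereal (1 / real 1) * log_abs v ?\<mu>" by (simp add: one_ereal_def[symmetric])
  also have "\<dots> \<le> max_multiplier_rate v f 1"
    using assms(2) fixed_multiplier_in_spectrum by (intro max_multiplier_rate_ge) blast
  finally show ?thesis .
qed

lemma max_multiplier_rate_2_ge:
  assumes "degree f \<ge> 2" "poly f (poly f z) = z" "poly f z \<noteq> z"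
    and "v (poly (pderiv f) z * poly (pderiv f) (poly f z)) \<ge> exp (2 * r)"
  shows "max_multiplier_rate v f 2 \<ge> ereal r"
proof -
  interpret iterated_polynomial f by unfold_locales fact
  let ?\<mu> = "poly (pderiv f) z * poly (pderiv f) (poly f z)"
  have "exp (2 * r) \<le> exp (ln (v ?\<mu>))" "?\<mu> \<noteq> 0"
    using assms(4) v_pos[of ?\<mu>] exp_gt_zero[of "2 * r"] by (auto simp del: exp_gt_zero)
  hence "ereal r \<le> ereal (1 / real 2) * log_abs v ?\<mu>" by (simp add: log_abs_def)
  also have "\<dots> \<le> max_multiplier_rate v f 2"
    using cycle_multiplier_in_spectrum[OF assms(2,3)] by (rule max_multiplier_rate_ge)
  finally show ?thesis .
qed

end

theorem corollary1p1:
  fixes v :: "'a :: {alg_closed_field, field_char_0} \<Rightarrow> real" and d :: nat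
  assumes "absolute_value v" and "d \<ge> 2"
  shows "(\<exists>A B :: real. A > 0 \<and>
            (\<forall>f :: 'a poly. degree f = d \<longrightarrow>
               max (max_multiplier_rate v f 1) (max_multiplier_rate v f 2)
                 \<ge> ereal (A * max_escape_rate v f + B))) \<and>
         (d \<in> {2, 3} \<longrightarrow>
          (\<exists>A B :: real. A > 0 \<and>
            (\<forall>f :: 'a poly. degree f = d \<longrightarrow>
               max_multiplier_rate v f 1 \<ge> ereal (A * max_escape_rate v f + B))))"
proof -
  interpret valued_field v by unfold_locales fact
  obtain A C :: real where A: "A > 0"
    "\<And>f. degree f = d \<Longrightarrow> max_escape_rate v f \<ge> C \<Longrightarrow>
       (\<exists>z. poly f z = z \<and> v (poly (pderiv f) z) > exp (A * max_escape_rate v f)) \<or>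
       (d \<ge> 4 \<and> (\<exists>z. poly f (poly f z) = z \<and> poly f z \<noteq> z \<and>
          v (poly (pderiv f) z * poly (pderiv f) (poly f z)) > exp (A * max_escape_rate v f)))"
    using exists_multiplier_ge_escape_rate[OF assms(2)] by metis
  obtain \<delta> where \<delta>: "0 < \<delta>" "\<delta> < 1"
    "\<And>f. degree f = d \<Longrightarrow> \<exists>z. poly f z = z \<and> v (poly (pderiv f) z) \<ge> \<delta>"
    using exists_fixed_multiplier_ge[OF assms(2)] by metis
  \<comment> \<open>The summand \<open>ln \<delta>\<close> is supplied by the fixed point from
    \<open>exists_fixed_multiplier_ge\<close>; the other one brings the bound down to
    \<open>ln \<delta>\<close> whenever the escape rate is below \<open>max 0 C\<close>.\<close>
  define B where "B = ln \<delta> - A / 2 * max 0 C"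
  have "ln \<delta> \<le> 0" using \<delta> by simp
  moreover have "A / 2 * max 0 C \<ge> 0" using A(1) by simp
  ultimately have B: "B \<le> 0" unfolding B_def by linarith
  \<comment> \<open>The slope \<open>A / 2\<close> reflects the factor 1/p for p = 2. The condition
    \<open>d \<ge> 4\<close> is carried along for the assertion on degrees 2 and 3.\<close>
  have main: "max_multiplier_rate v f 1 \<ge> ereal (A / 2 * max_escape_rate v f + B) \<or>
      d \<ge> 4 \<and> max_multiplier_rate v f 2 \<ge> ereal (A / 2 * max_escape_rate v f + B)"
    if f: "degree f = d" for f
  proof (cases "max_escape_rate v f \<ge> max 0 C")
    case True
    let ?M = "max_escape_rate v f"
    have AM: "A * ?M \<ge> 0" using A(1) True by simp
    from A(2)[OF f] True consider
      z where "poly f z = z" "v (poly (pderiv f) z) > exp (A * ?M)"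
    | z where "d \<ge> 4" "poly f (poly f z) = z" "poly f z \<noteq> z"
        "v (poly (pderiv f) z * poly (pderiv f) (poly f z)) > exp (A * ?M)"
      by auto
    thus ?thesis
    proof cases
      case 1
      have "exp (A / 2 * ?M + B) \<le> exp (A * ?M)" using AM B by simp
      hence "exp (A / 2 * ?M + B) \<le> v (poly (pderiv f) z)" using 1(2) by linarith
      thus ?thesis using 1(1) f assms(2) by (intro disjI1 max_multiplier_rate_1_ge[of f z]) simp_all
    next
      case 2
      have "exp (2 * (A / 2 * ?M + B)) \<le> exp (A * ?M)" using B by simp
      hence "exp (2 * (A / 2 * ?M + B)) \<le> v (poly (pderiv f) z * poly (pderiv f) (poly f z))"
        using 2(4) by linarith
      thus ?thesis using 2(1-3) f assms(2)
        by (intro disjI2 conjI max_multiplier_rate_2_ge[of f z]) simp_all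
    qed
  next
    case False
    have "A / 2 * max_escape_rate v f \<le> A / 2 * max 0 C"
      using False A(1) by (intro mult_left_mono) auto
    hence "A / 2 * max_escape_rate v f + B \<le> ln \<delta>" by (simp add: B_def)
    hence "exp (A / 2 * max_escape_rate v f + B) \<le> exp (ln \<delta>)" by (simp only: exp_le_cancel_iff)
    moreover obtain z where "poly f z = z" "v (poly (pderiv f) z) \<ge> \<delta>" using \<delta>(3)[OF f] by blast
    ultimately show ?thesis
      using f assms(2) \<delta>(1) by (intro disjI1 max_multiplier_rate_1_ge[of f z]) auto
  qed
  have "A / 2 > 0" using A(1) by simp
  moreover have "max (max_multiplier_rate v f 1) (max_multiplier_rate v f 2)
      \<ge> ereal (A / 2 * max_escape_rate v f + B)" if "degree f = d" for f
    using main[OF that] by (auto simp: le_max_iff_disj)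
  moreover have "max_multiplier_rate v f 1 \<ge> ereal (A / 2 * max_escape_rate v f + B)"
    if "d \<in> {2, 3}" "degree f = d" for f
    using main[OF that(2)] that(1) by auto
  ultimately show ?thesis by blast
qed

end
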